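(* For every $\lambda>0$, $t>0$ and $x,y\in\mathbb{R}^d\setminus\{0\}$, $$p^\lambda(t,x,y)\ge p(t,x,y)\exp\Big[-\frac{\lambda\,p_1(t,x,y)}{p(t,x,y)}\Big].$$
   Context: Let $d\ge1$ be an integer and $\alpha\in(0,d\wedge2)$. Let $p(t,x,y)=p(t,x-y)$ be the heat kernel of $\Delta^{\alpha/2}=-(-\Delta)^{\alpha/2}$ on $\mathbb{R}^d$, i.e. the transition density of the rotationally symmetric $\alpha$-stable process $(X_t)$. For $\lambda\ge0$, $p^\lambda(t,x,y)$ denotes the heat kernel of $\Delta^{\alpha/2}-\lambda|x|^{-\alpha}$, i.e. the kernel on $\mathbb{R}^d\setminus\{0\}$ of the Feynman–Kac semigroup $f\mapsto\mathbb{E}^x[f(X_t)\exp(-\lambda\int_0^t|X_s|^{-\alpha}ds)]$. Define $p_1(t,x,y)=\int_0^t\int_{\mathbb{R}^d}p(t-s,x,z)|z|^{-\alpha}p(s,z,y)\,dz\,ds$ for $t>0$, $x,y\ne0$. *)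

theory Defs
  imports "HOL-Probability.Probability"
begin

text \<open>Heat kernel p(t,z) of the fractional Laplacian on the euclidean space 'a (dimension
  DIM('a) = d), defined by Fourier inversion of the characteristic function exp(-t|xi|^alpha).
  Then p(t,x,y) = stable_kernel alpha t (x - y).\<close>
definition stable_kernel :: "real \<Rightarrow> real \<Rightarrow> 'a::euclidean_space \<Rightarrow> real" where
  "stable_kernel \<alpha> t z =
     (1 / (2 * pi) ^ DIM('a)) *
     (\<integral>\<xi>. exp (- t * norm \<xi> powr \<alpha>) * cos (\<xi> \<bullet> z) \<partial>(lborel :: 'a measure))"

definition p1 :: "real \<Rightarrow> real \<Rightarrow> 'a::euclidean_space \<Rightarrow> 'a \<Rightarrow> real" where
  "p1 \<alpha> t x y =
     (\<integral>s. indicator {0<..<t} s *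
        (\<integral>z. stable_kernel \<alpha> (t - s) (x - z) * norm z powr (- \<alpha>) * stable_kernel \<alpha> s (z - y)
          \<partial>(lborel :: 'a measure)) \<partial>lborel)"

definition stable_process ::
    "real \<Rightarrow> 'b measure \<Rightarrow> (real \<Rightarrow> 'b \<Rightarrow> 'a::euclidean_space) \<Rightarrow> 'a \<Rightarrow> bool" where
  "stable_process \<alpha> M X x \<longleftrightarrow>
     prob_space M \<and>
     (\<lambda>(s, \<omega>). X s \<omega>) \<in> borel_measurable (lborel \<Otimes>\<^sub>M M) \<and>
     (AE \<omega> in M. X 0 \<omega> = x) \<and>
     (\<forall>s :: nat \<Rightarrow> real. s 0 = 0 \<longrightarrow> strict_mono s \<longrightarrow>
        (\<forall>n. prob_space.indep_vars M (\<lambda>_. borel)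
                (\<lambda>i \<omega>. X (s (Suc i)) \<omega> - X (s i) \<omega>) {..<n}) \<and>
        (\<forall>i. distributed M lborel (\<lambda>\<omega>. X (s (Suc i)) \<omega> - X (s i) \<omega>)
                (\<lambda>z. ennreal (stable_kernel \<alpha> (s (Suc i) - s i) z))))"

definition fk_weight :: "real \<Rightarrow> real \<Rightarrow> real \<Rightarrow> (real \<Rightarrow> 'b \<Rightarrow> 'a::euclidean_space) \<Rightarrow> 'b \<Rightarrow> real" where
  "fk_weight \<alpha> lam t X \<omega> =
     (let I = (\<integral>\<^sup>+ s. indicator {0..t} s * ennreal (norm (X s \<omega>) powr (- \<alpha>)) \<partial>lborel)
      in if I = \<infinity> then 0 else exp (- lam * enn2real I))"

text \<open>q is a density of the Feynman--Kac measure A |-> E^x[1_A(X_t) exp(-lambda int_0^t |X_s|^(-alpha) ds)],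
  i.e. q = p^lambda(t,x,.) (a.e.).\<close>
definition fk_density ::
    "real \<Rightarrow> real \<Rightarrow> 'b measure \<Rightarrow> (real \<Rightarrow> 'b \<Rightarrow> 'a::euclidean_space) \<Rightarrow> real \<Rightarrow> ('a \<Rightarrow> real) \<Rightarrow> bool" where
  "fk_density \<alpha> lam M X t q \<longleftrightarrow>
     (\<forall>A \<in> sets borel.
        (\<integral>\<^sup>+ y. indicator A y * ennreal (q y) \<partial>lborel) =
        (\<integral>\<^sup>+ \<omega>. indicator A (X t \<omega>) * ennreal (fk_weight \<alpha> lam t X \<omega>) \<partial>M))"

end

theory Submission
  imports Defs "HOL-Real_Asymp.Real_Asymp"
begin

text \<open>
  The tangent line inequality \<open>exp (-\<lambda>I) \<ge> exp (-\<lambda>c) (1 + \<lambda>c - \<lambda>I)\<close>, applied to the additive functional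
  \<open>I = \<integral>\<^sub>0\<^sup>t \<bar>X\<^sub>s\<bar>\<^sup>-\<^sup>\<alpha> ds\<close> and integrated over \<open>{X\<^sub>t \<in> A}\<close>, gives by Tonelli and the Markov property
  \<open>\<integral>\<^sub>A q \<ge> exp (-\<lambda>c) ((1 + \<lambda>c) \<integral>\<^sub>A p - \<lambda> \<integral>\<^sub>A p\<^sub>1)\<close>. Shrinking \<open>A\<close> to the point \<open>y\<close> and choosing
  \<open>c = p\<^sub>1 / p\<close> yields the claim, provided that \<open>p\<^sub>1(t, x, \<cdot>)\<close> is finite and continuous away from \<open>0\<close>.
  No sharp heat kernel estimate is needed for that: the on-diagonal bound \<open>p(s, z) \<le> C s\<^bsup>-d/\<alpha>\<^esup>\<close> and the
  tail bound \<open>P(\<bar>X\<^sub>s - x\<bar> \<ge> R) \<le> C s R\<^bsup>-\<alpha>\<^esup>\<close>, which follows from the characteristic function, suffice.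
\<close>

subsection \<open>Radial integrals and the Gaussian\<close>

text \<open>Behind the tangent line stands Jensen's inequality for the process conditioned on
  \<open>X t = y\<close>: \<open>p1 / p\<close> is the conditional mean of \<open>I\<close>, and the
  tangent at the mean is what proves Jensen. Working with the events \<open>{X t \<in> A}\<close>
  avoids constructing the bridge.

  The obstacle is the kernel itself. It is given as a cosine integral, from which neither its sign
  nor its integrability can be read off. The process supplies one fact: an increment has density
  \<open>ennreal (stable_kernel \<alpha> s z)\<close>, so this function has total mass one, and
  \<open>ennreal\<close> cuts off negative values. The averages of the kernel against wide Gaussians
  are computable from the characteristic function and tend to one at a known rate; comparing them
  with the mass of the positive part leaves no room for a negative part and also bounds the tail.

  A divergent Bochner integral has the value 0, so \<open>p1\<close> carries its intended meaning
  only once finiteness is proved. Finally, \<open>fk_density\<close> fixes \<open>q\<close> only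
  almost everywhere, which is why the argument has to end with continuity at
  \<open>y\<close>.\<close>

lemma integrable_lborel_decay:
  fixes f :: "'a::euclidean_space \<Rightarrow> real"
  assumes [measurable]: "f \<in> borel_measurable borel"
    and bound: "\<And>\<xi>. \<bar>f \<xi>\<bar> * (1 + (norm \<xi>)\<^sup>2) ^ DIM('a) \<le> C"
  shows "integrable lborel f"
proof (rule Bochner_Integration.integrable_bound)
  \<comment> \<open>The majorant factors over the coordinates, so its integral is a power of the
    one-dimensional integral of \<open>1 / (1 + x^2)\<close>. It dominates because each factor
    \<open>1 + (\<xi> \<bullet> b)^2\<close> is at most \<open>1 + (norm \<xi>)^2\<close>.\<close>
  let ?g = "\<lambda>\<xi>::'a. C * (\<Prod>b\<in>Basis. inverse (1 + (\<xi> \<bullet> b)\<^sup>2))"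
  have 1: "(\<integral>\<^sup>+x. ennreal (inverse (1 + x\<^sup>2)) \<partial>lborel) < \<infinity>"
    using integrable_inverse_1_plus_square
    by (simp add: set_integrable_def integrable_iff_bounded)
  have "(\<integral>\<^sup>+\<xi>. (\<Prod>b\<in>Basis. ennreal (inverse (1 + (\<xi> \<bullet> b)\<^sup>2))) \<partial>(lborel::'a measure)) < \<infinity>"
    using 1 by (subst nn_integral_lborel_prod) (auto simp: power_less_top_ennreal)
  hence "integrable lborel (\<lambda>\<xi>::'a. \<Prod>b\<in>Basis. inverse (1 + (\<xi> \<bullet> b)\<^sup>2))"
    by (auto simp: integrable_iff_bounded prod_ennreal prod_nonneg)
  thus "integrable lborel ?g" by (rule integrable_mult_right)
  have "norm (f \<xi>) \<le> norm (?g \<xi>)" for \<xi> :: 'a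
  proof -
    have "(\<Prod>b\<in>(Basis::'a set). (1 + (\<xi> \<bullet> b)\<^sup>2)) \<le> (\<Prod>b\<in>(Basis::'a set). 1 + (norm \<xi>)\<^sup>2)"
      by (intro prod_mono conjI add_left_mono) (auto intro: power_mono Basis_le_norm simp: abs_le_square_iff[symmetric])
    also have "\<dots> = (1 + (norm \<xi>)\<^sup>2) ^ DIM('a)" by simp
    finally have le: "(\<Prod>b\<in>(Basis::'a set). (1 + (\<xi> \<bullet> b)\<^sup>2)) \<le> (1 + (norm \<xi>)\<^sup>2) ^ DIM('a)" .
    have pos: "0 < (\<Prod>b\<in>(Basis::'a set). (1 + (\<xi> \<bullet> b)\<^sup>2))"
      by (intro prod_pos) (auto intro: add_pos_nonneg)
    have "\<bar>f \<xi>\<bar> * (\<Prod>b\<in>(Basis::'a set). (1 + (\<xi> \<bullet> b)\<^sup>2)) \<le> C"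
      using mult_left_mono[OF le, of "\<bar>f \<xi>\<bar>"] bound[of \<xi>] by simp
    hence "\<bar>f \<xi>\<bar> \<le> ?g \<xi>"
      using pos unfolding prod_inversef[unfolded o_def] by (simp add: field_simps)
    thus ?thesis by simp
  qed
  thus "AE \<xi> in lborel. norm (f \<xi>) \<le> norm (?g \<xi>)" by simp
qed simp

text \<open>A substitute for polar coordinates: continuity settles bounded radii, and what remains
  is a limit in one real variable, within reach of \<open>real_asymp\<close>.\<close>

lemma integrable_lborel_radial:
  fixes g :: "real \<Rightarrow> real"
  assumes cont: "continuous_on {0..} g"
    and lim: "((\<lambda>r. g r * (1 + r\<^sup>2) ^ DIM('a)) \<longlongrightarrow> 0) at_top"
  shows "integrable lborel (\<lambda>\<xi>::'a::euclidean_space. g (norm \<xi>))"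
proof -
  let ?h = "\<lambda>r. g r * (1 + r\<^sup>2) ^ DIM('a)"
  have "eventually (\<lambda>r. dist (?h r) 0 < 1) at_top"
    using lim by (rule tendstoD) simp
  then obtain R where R: "\<And>r. R \<le> r \<Longrightarrow> \<bar>?h r\<bar> < 1"
    by (auto simp: eventually_at_top_linorder)
  have "compact (?h ` {0..R})"
    by (intro compact_continuous_image continuous_intros continuous_on_subset[OF cont]) auto
  then obtain B where B: "\<And>r. 0 \<le> r \<Longrightarrow> r \<le> R \<Longrightarrow> \<bar>?h r\<bar> \<le> B"
    by (fastforce dest!: compact_imp_bounded simp: bounded_iff)
  have bd: "\<bar>?h r\<bar> \<le> max B 1" if "0 \<le> r" for r
    using B[of r] R[of r] that by linarith
  have "continuous_on UNIV (\<lambda>\<xi>::'a. g (norm \<xi>))"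
    by (rule continuous_on_compose2[OF cont]) (auto intro: continuous_intros)
  hence m: "(\<lambda>\<xi>::'a. g (norm \<xi>)) \<in> borel_measurable borel"
    by (rule borel_measurable_continuous_onI)
  show ?thesis
    by (rule integrable_lborel_decay[OF m, where C = "max B 1"])
       (use bd[OF norm_ge_zero] in \<open>simp add: abs_mult\<close>)
qed

lemma integrable_exp_norm_powr:
  fixes t \<alpha> :: real
  assumes "0 < t" "0 < \<alpha>"
  shows "integrable lborel (\<lambda>\<xi>::'a::euclidean_space. exp (- t * norm \<xi> powr \<alpha>))"
proof (rule integrable_lborel_radial)
  show "continuous_on {0..} (\<lambda>r. exp (- t * r powr \<alpha>))"
    using assms by (intro continuous_intros continuous_on_powr') auto
  show "((\<lambda>r. exp (- t * r powr \<alpha>) * (1 + r\<^sup>2) ^ DIM('a)) \<longlongrightarrow> 0) at_top"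
    using assms by real_asymp
qed

definition gauss :: "'a::euclidean_space \<Rightarrow> real" where
  "gauss \<xi> = exp (- (norm \<xi>)\<^sup>2 / 2) / sqrt (2 * pi) ^ DIM('a)"

lemma gauss_measurable [measurable]: "gauss \<in> borel_measurable borel"
  unfolding gauss_def by measurable

lemma gauss_pos: "0 < gauss \<xi>"
  by (simp add: gauss_def)

lemma gauss_eq_prod: "gauss (\<xi>::'a::euclidean_space) = (\<Prod>b\<in>Basis. std_normal_density (\<xi> \<bullet> b))"
proof -
  have "(norm \<xi>)\<^sup>2 = (\<Sum>b\<in>Basis. (\<xi> \<bullet> b)\<^sup>2)"
    by (subst euclidean_inner[of \<xi> \<xi>, folded power2_norm_eq_inner]) (simp add: power2_eq_square)
  thus ?thesis
    by (simp add: gauss_def std_normal_density_def prod_dividef exp_sum[symmetric] sum_negf sum_divide_distrib)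
qed

lemma integrable_gauss_powr:
  assumes "0 < \<alpha>"
  shows "integrable lborel (\<lambda>\<xi>::'a::euclidean_space. gauss \<xi> * norm \<xi> powr \<alpha>)"
proof -
  have "integrable lborel (\<lambda>\<xi>::'a. exp (- (norm \<xi>)\<^sup>2 / 2) / sqrt (2 * pi) ^ DIM('a) * norm \<xi> powr \<alpha>)"
  proof (rule integrable_lborel_radial)
    show "continuous_on {0..} (\<lambda>r. exp (- r\<^sup>2 / 2) / sqrt (2 * pi) ^ DIM('a) * r powr \<alpha>)"
      using assms by (intro continuous_intros continuous_on_powr') auto
    have "((\<lambda>r. exp (- r\<^sup>2 / 2) * r powr \<alpha> * (1 + r\<^sup>2) ^ DIM('a)) \<longlongrightarrow> 0) at_top"
      using assms by real_asymp
    from tendsto_divide[OF this tendsto_const, of "sqrt (2 * pi) ^ DIM('a)"]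
    show "((\<lambda>r. exp (- r\<^sup>2 / 2) / sqrt (2 * pi) ^ DIM('a) * r powr \<alpha> * (1 + r\<^sup>2) ^ DIM('a)) \<longlongrightarrow> 0) at_top"
      by (simp add: field_simps)
  qed
  thus ?thesis by (simp add: gauss_def)
qed

lemma integrable_gauss: "integrable lborel (gauss :: 'a::euclidean_space \<Rightarrow> real)"
proof -
  have "integrable lborel (\<lambda>\<xi>::'a. exp (- (1/2) * norm \<xi> powr 2) / sqrt (2 * pi) ^ DIM('a))"
    by (intro integrable_divide integrable_exp_norm_powr) auto
  thus ?thesis by (simp add: gauss_def[abs_def])
qed

text \<open>\<open>iexp\<close> factors over the coordinates while the cosine does not. The
  computation is therefore complex: a product of characteristic functions of the standard normal
  law, with the real part taken at the end.\<close>

lemma gauss_fourier: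
  "(\<integral>z. gauss z * cos (\<xi> \<bullet> z) \<partial>lborel) = exp (- (norm (\<xi>::'a::euclidean_space))\<^sup>2 / 2)"
proof -
  interpret product_sigma_finite "\<lambda>_::'a. lborel :: real measure" ..
  let ?f = "\<lambda>b u. complex_of_real (std_normal_density u) * iexp ((\<xi> \<bullet> b) * u)"
  have int1: "integrable lborel (?f b)" for b
    by (rule Bochner_Integration.integrable_bound[where f = std_normal_density])
       (auto simp: norm_mult)
  have val1: "integral\<^sup>L lborel (?f b) = exp (- (\<xi> \<bullet> b)\<^sup>2 / 2)" for b
  proof -
    have "integral\<^sup>L lborel (?f b) = char std_normal_distribution (\<xi> \<bullet> b)"
      unfolding char_def by (subst integral_density) (auto simp: scaleR_conv_of_real)
    thus ?thesis by (simp add: char_std_normal_distribution)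
  qed
  have prod: "(\<Prod>b\<in>Basis. ?f b (z \<bullet> b)) = complex_of_real (gauss z) * iexp (\<xi> \<bullet> z)" for z
    by (simp add: prod.distrib gauss_eq_prod exp_sum[symmetric] sum_distrib_left[symmetric]
        euclidean_inner[of \<xi> z] del: of_real_mult of_real_exp)
  have "(\<integral>z. complex_of_real (gauss z) * iexp (\<xi> \<bullet> z) \<partial>lborel) =
      (\<integral>x. (\<Prod>b\<in>Basis. ?f b ((\<Sum>c\<in>Basis. x c *\<^sub>R c) \<bullet> b)) \<partial>(\<Pi>\<^sub>M b\<in>Basis. lborel))"
    unfolding prod by (subst lborel_eq, subst integral_distr) auto
  also have "\<dots> = (\<integral>x. (\<Prod>b\<in>Basis. ?f b (x b)) \<partial>(\<Pi>\<^sub>M b\<in>Basis. lborel))"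
    by (intro Bochner_Integration.integral_cong refl prod.cong) (auto simp: inner_sum_left inner_Basis if_distrib cong: if_cong)
  also have "\<dots> = (\<Prod>b\<in>Basis. integral\<^sup>L lborel (?f b))"
    by (rule product_integral_prod) (use int1 in auto)
  also have "\<dots> = exp (- (norm \<xi>)\<^sup>2 / 2)"
  proof -
    have "(norm \<xi>)\<^sup>2 = (\<Sum>b\<in>Basis. (\<xi> \<bullet> b)\<^sup>2)"
      by (subst euclidean_inner[of \<xi> \<xi>, folded power2_norm_eq_inner]) (simp add: power2_eq_square)
    thus ?thesis
      unfolding val1
      by (simp add: exp_sum[symmetric] sum_negf sum_divide_distrib flip: of_real_prod)
  qed
  finally have *: "(\<integral>z. complex_of_real (gauss z) * iexp (\<xi> \<bullet> z) \<partial>lborel) = exp (- (norm \<xi>)\<^sup>2 / 2)" .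
  have "integrable lborel (\<lambda>z. complex_of_real (gauss z) * iexp (\<xi> \<bullet> z))"
    by (rule Bochner_Integration.integrable_bound[OF integrable_gauss]) (auto simp: norm_mult)
  from integral_Re[OF this] show ?thesis
    using * by (simp add: Re_exp)
qed

subsection \<open>The stable kernel\<close>

lemma integral_lborel_scale:
  fixes f :: "'a::euclidean_space \<Rightarrow> real"
  assumes [measurable]: "f \<in> borel_measurable borel" and "c > 0"
  shows "(\<integral>\<xi>. f \<xi> \<partial>lborel) = c ^ DIM('a) * (\<integral>\<xi>. f (c *\<^sub>R \<xi>) \<partial>lborel)"
proof -
  have "(\<integral>\<xi>. f \<xi> \<partial>lborel) =
      (\<integral>\<xi>. f \<xi> \<partial>density (distr lborel borel (\<lambda>x. 0 + c *\<^sub>R x)) (\<lambda>_. ennreal (\<bar>c\<bar> ^ DIM('a))))"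
    using lborel_affine[of c "0::'a"] \<open>c > 0\<close> by simp
  also have "\<dots> = c ^ DIM('a) * (\<integral>\<xi>. f (c *\<^sub>R \<xi>) \<partial>lborel)"
    using \<open>c > 0\<close> by (subst integral_density) (auto simp: integral_distr)
  finally show ?thesis .
qed

lemma nn_integral_lborel_translate:
  fixes f :: "'a::euclidean_space \<Rightarrow> ennreal"
  assumes [measurable]: "f \<in> borel_measurable borel"
  shows "(\<integral>\<^sup>+z. f (z - a) \<partial>lborel) = (\<integral>\<^sup>+z. f z \<partial>lborel)"
proof -
  have "(\<integral>\<^sup>+z. f z \<partial>lborel) = (\<integral>\<^sup>+z. f z \<partial>distr lborel borel ((+) (- a)))"
    unfolding lborel_distr_plus ..
  also have "\<dots> = (\<integral>\<^sup>+z. f (z - a) \<partial>lborel)"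
    by (subst nn_integral_distr) auto
  finally show ?thesis ..
qed

lemma stable_kernel_measurable [measurable]:
  "(\<lambda>(s, z). stable_kernel \<alpha> s (z::'a::euclidean_space)) \<in> borel_measurable (borel \<Otimes>\<^sub>M borel)"
  unfolding stable_kernel_def case_prod_beta
  by (intro borel_measurable_times borel_measurable_const
        sigma_finite_measure.borel_measurable_lebesgue_integral[OF sigma_finite_lborel])
     measurable

lemma stable_kernel_measurable' [measurable (raw)]:
  fixes g :: "'c \<Rightarrow> 'a::euclidean_space"
  assumes "f \<in> borel_measurable N" "g \<in> borel_measurable N"
  shows "(\<lambda>w. stable_kernel \<alpha> (f w) (g w)) \<in> borel_measurable N"
  using measurable_compose[OF measurable_Pair[OF assms] stable_kernel_measurable] by simp

lemma stable_kernel_minus: "stable_kernel \<alpha> t (- z) = stable_kernel \<alpha> t z"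
  by (simp add: stable_kernel_def)

lemma stable_kernel_minus_commute: "stable_kernel \<alpha> t (x - y) = stable_kernel \<alpha> t (y - x)"
  using stable_kernel_minus[of \<alpha> t "x - y"] by simp

lemma integrable_stable_kernel_integrand:
  fixes z :: "'a::euclidean_space"
  assumes "0 < t" "0 < \<alpha>"
  shows "integrable lborel (\<lambda>\<xi>. exp (- t * norm \<xi> powr \<alpha>) * cos (\<xi> \<bullet> z))"
  by (rule Bochner_Integration.integrable_bound[OF integrable_exp_norm_powr[OF assms]])
     (auto simp: abs_mult)

lemma stable_kernel_abs_le:
  fixes z :: "'a::euclidean_space"
  assumes "0 < t" "0 < \<alpha>"
  shows "\<bar>stable_kernel \<alpha> t z\<bar> \<le> stable_kernel \<alpha> t (0::'a)"
proof -
  have "norm (\<integral>\<xi>. exp (- t * norm \<xi> powr \<alpha>) * cos (\<xi> \<bullet> z) \<partial>lborel)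
      \<le> (\<integral>\<xi>. exp (- t * norm \<xi> powr \<alpha>) \<partial>(lborel::'a measure))"
    using Bochner_Integration.integral_norm_bound_integral[OF integrable_stable_kernel_integrand[OF assms, of z] integrable_exp_norm_powr[OF assms]]
    by (auto simp: abs_mult)
  thus ?thesis
    by (simp add: stable_kernel_def abs_mult divide_right_mono)
qed

text \<open>Self-similarity: rescaling \<open>\<xi>\<close> by
  \<open>t powr (- 1 / \<alpha>)\<close> absorbs \<open>t\<close> into the exponent. With
  \<open>stable_kernel_abs_le\<close> this becomes the on-diagonal bound.\<close>

lemma stable_kernel_scale_0:
  assumes "0 < t" "0 < \<alpha>"
  shows "stable_kernel \<alpha> t (0::'a::euclidean_space) =
    t powr (- real DIM('a) / \<alpha>) * stable_kernel \<alpha> 1 (0::'a)"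
proof -
  define c where "c = t powr (- 1 / \<alpha>)"
  have c: "c > 0" using assms by (simp add: c_def)
  have "t * c powr \<alpha> = 1"
    using assms unfolding c_def powr_powr by (simp add: powr_minus_divide)
  hence "t * (c * r) powr \<alpha> = r powr \<alpha>" if "r \<ge> 0" for r
    using c that by (simp add: powr_mult flip: mult.assoc)
  hence "(\<integral>\<xi>. exp (- t * norm \<xi> powr \<alpha>) \<partial>(lborel::'a measure)) =
    c ^ DIM('a) * (\<integral>\<xi>. exp (- (norm \<xi> powr \<alpha>)) \<partial>(lborel::'a measure))"
    using c by (subst integral_lborel_scale[OF _ c]) simp_all
  moreover have "c ^ DIM('a) = t powr (- real DIM('a) / \<alpha>)"
    using assms by (simp add: c_def powr_power)
  ultimately show ?thesis by (simp add: stable_kernel_def)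
qed

lemma stable_kernel_0_nonneg: "0 \<le> stable_kernel \<alpha> t 0"
  by (simp add: stable_kernel_def)

lemma isCont_stable_kernel:
  fixes z :: "'a::euclidean_space"
  assumes "0 < t" "0 < \<alpha>"
  shows "isCont (stable_kernel \<alpha> t) z"
  unfolding continuous_at_sequentially
proof (intro allI impI)
  fix u :: "nat \<Rightarrow> 'a" assume u: "u \<longlonglongrightarrow> z"
  have "(\<lambda>n. \<integral>\<xi>. exp (- t * norm \<xi> powr \<alpha>) * cos (\<xi> \<bullet> u n) \<partial>lborel)
      \<longlonglongrightarrow> (\<integral>\<xi>. exp (- t * norm \<xi> powr \<alpha>) * cos (\<xi> \<bullet> z) \<partial>lborel)"
    by (rule integral_dominated_convergence[OF _ _ integrable_exp_norm_powr[OF assms]])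
       (use assms u in \<open>auto intro!: tendsto_intros simp: abs_mult\<close>)
  thus "(stable_kernel \<alpha> t \<circ> u) \<longlonglongrightarrow> stable_kernel \<alpha> t z"
    unfolding stable_kernel_def o_def by (intro tendsto_intros)
qed

section \<open>Gaussian averages of the kernel, its sign and its tail\<close>

lemma exp_neg_square_eq_gauss:
  "exp (- (\<sigma> * norm z)\<^sup>2 / 2) = sqrt (2 * pi) ^ DIM('a) * gauss (\<bar>\<sigma>\<bar> *\<^sub>R z)" for z :: "'a::euclidean_space"
  by (simp add: gauss_def power_mult_distrib)

lemma integrable_exp_neg_square:
  assumes "\<sigma> > 0"
  shows "integrable lborel (\<lambda>z::'a::euclidean_space. exp (- (\<sigma> * norm z)\<^sup>2 / 2))"
proof -
  have "integrable lborel (\<lambda>z::'a. exp (- (\<sigma>\<^sup>2 / 2) * norm z powr 2))"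
    using assms by (intro integrable_exp_norm_powr) auto
  thus ?thesis by (simp add: power_mult_distrib)
qed

text \<open>Parseval's identity: after exchanging the integrals it is the Gaussian that gets
  transformed, and \<open>\<xi>\<close> is then rescaled by \<open>\<sigma>\<close>. Fubini rests on
  the Gaussian decay in \<open>z\<close> and the exponential decay in \<open>\<xi>\<close>;
  integrability of the kernel is still open here.\<close>

lemma stable_kernel_gauss:
  assumes "0 < t" "0 < \<alpha>" "0 < \<sigma>"
  shows "(\<integral>z. stable_kernel \<alpha> t z * exp (- (\<sigma> * norm (z::'a::euclidean_space))\<^sup>2 / 2) \<partial>lborel) =
    (\<integral>\<eta>. gauss (\<eta>::'a) * exp (- t * \<sigma> powr \<alpha> * norm \<eta> powr \<alpha>) \<partial>lborel)"
proof -
  let ?e = "\<lambda>\<xi>::'a. exp (- t * norm \<xi> powr \<alpha>)"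
  let ?g = "\<lambda>z::'a. exp (- (\<sigma> * norm z)\<^sup>2 / 2)"
  let ?c = "1 / (2 * pi) ^ DIM('a)"
  let ?r = "sqrt (2 * pi) ^ DIM('a)"
  have inner: "(\<integral>z. ?g z * cos (\<xi> \<bullet> z) \<partial>lborel) =
      ?r / \<sigma> ^ DIM('a) * exp (- (norm \<xi> / \<sigma>)\<^sup>2 / 2)" for \<xi> :: 'a
  proof -
    have "(\<integral>z. gauss z * cos (((1/\<sigma>) *\<^sub>R \<xi>) \<bullet> z) \<partial>lborel) =
        \<sigma> ^ DIM('a) * (\<integral>z. gauss (\<sigma> *\<^sub>R z) * cos (\<xi> \<bullet> z) \<partial>lborel)"
      using assms by (subst integral_lborel_scale[OF _ assms(3)]) auto
    hence "\<sigma> ^ DIM('a) * (\<integral>z. gauss (\<sigma> *\<^sub>R z) * cos (\<xi> \<bullet> z) \<partial>lborel) = exp (- (norm \<xi> / \<sigma>)\<^sup>2 / 2)"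
      using assms unfolding gauss_fourier by simp
    hence "(\<integral>z. gauss (\<sigma> *\<^sub>R z) * cos (\<xi> \<bullet> z) \<partial>lborel) = exp (- (norm \<xi> / \<sigma>)\<^sup>2 / 2) / \<sigma> ^ DIM('a)"
      using assms by (simp add: field_simps)
    thus ?thesis
      using assms unfolding exp_neg_square_eq_gauss mult.assoc by simp
  qed
  have "integrable (lborel \<Otimes>\<^sub>M lborel) (\<lambda>(z::'a, \<xi>::'a). ?g z * ?e \<xi>)"
  proof (intro lborel_pair.Fubini_integrable)
    have "integrable lborel (\<lambda>z::'a. ?g z * (\<integral>\<xi>. ?e \<xi> \<partial>(lborel::'a measure)))"
      by (intro integrable_mult_left integrable_exp_neg_square assms)
    thus "integrable lborel (\<lambda>z::'a. \<integral>\<xi>. norm (case (z, \<xi>) of (z, \<xi>) \<Rightarrow> ?g z * ?e \<xi>) \<partial>(lborel::'a measure))"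
      by (simp add: abs_mult)
    have "integrable lborel (\<lambda>\<xi>::'a. ?g z * ?e \<xi>)" for z
      by (intro integrable_mult_right integrable_exp_norm_powr assms)
    thus "AE z in lborel. integrable lborel (\<lambda>\<xi>::'a. case (z, \<xi>) of (z, \<xi>) \<Rightarrow> ?g z * ?e \<xi>)"
      by simp
  qed measurable
  hence F: "integrable (lborel \<Otimes>\<^sub>M lborel) (\<lambda>(z::'a, \<xi>::'a). ?g z * (?e \<xi> * cos (\<xi> \<bullet> z)))"
    by (rule Bochner_Integration.integrable_bound) (auto simp: abs_mult mult_left_le)
  have "(\<integral>z. stable_kernel \<alpha> t z * ?g z \<partial>lborel) =
      ?c * (\<integral>z. (\<integral>\<xi>. ?g z * (?e \<xi> * cos (\<xi> \<bullet> z)) \<partial>lborel) \<partial>lborel)"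
    by (simp add: stable_kernel_def) (simp add: mult.commute)
  also have "\<dots> = ?c * (\<integral>\<xi>. (\<integral>z. ?g z * (?e \<xi> * cos (\<xi> \<bullet> z)) \<partial>lborel) \<partial>lborel)"
    using lborel_pair.Fubini_integral[OF F] by simp
  also have "\<dots> = ?c * (\<integral>\<xi>. ?e \<xi> * (\<integral>z. ?g z * cos (\<xi> \<bullet> z) \<partial>lborel) \<partial>lborel)"
  proof -
    have swap: "?g z * (?e \<xi> * cos (\<xi> \<bullet> z)) = ?e \<xi> * (?g z * cos (\<xi> \<bullet> z))" for z \<xi> by (rule mult.left_commute)
    show ?thesis unfolding swap by simp
  qed
  also have "\<dots> = ?c * (\<integral>\<xi>. ?e \<xi> * (?r / \<sigma> ^ DIM('a) * exp (- (norm \<xi> / \<sigma>)\<^sup>2 / 2)) \<partial>lborel)"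
    unfolding inner ..
  also have "\<dots> = ?c * (\<sigma> ^ DIM('a) * (\<integral>\<eta>. ?e (\<sigma> *\<^sub>R \<eta>) * (?r / \<sigma> ^ DIM('a) * exp (- (norm \<eta>)\<^sup>2 / 2)) \<partial>lborel))"
    using assms by (subst integral_lborel_scale[OF _ assms(3)]) auto
  also have "\<dots> = (\<integral>\<eta>. ?c * (\<sigma> ^ DIM('a) * (?e (\<sigma> *\<^sub>R \<eta>) * (?r / \<sigma> ^ DIM('a) * exp (- (norm \<eta>)\<^sup>2 / 2)))) \<partial>lborel)"
    by simp
  also have "\<dots> = (\<integral>\<eta>. gauss (\<eta>::'a) * exp (- t * \<sigma> powr \<alpha> * norm \<eta> powr \<alpha>) \<partial>lborel)"
  proof (rule Bochner_Integration.integral_cong[OF refl])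
    fix \<eta> :: 'a
    have r2: "?r * ?r = (2 * pi) ^ DIM('a)"
      by (subst power_mult_distrib[symmetric]) simp
    have "?e (\<sigma> *\<^sub>R \<eta>) = exp (- t * \<sigma> powr \<alpha> * norm \<eta> powr \<alpha>)"
      using assms by (simp add: powr_mult mult_ac)
    moreover have "1 / (r * r) * (s * (e * (r / s * f))) = f / r * e" if "r \<noteq> 0" "s \<noteq> 0" for r s e f :: real
      using that by (simp add: field_simps)
    ultimately show "?c * (\<sigma> ^ DIM('a) * (?e (\<sigma> *\<^sub>R \<eta>) * (?r / \<sigma> ^ DIM('a) * exp (- (norm \<eta>)\<^sup>2 / 2)))) =
        gauss \<eta> * exp (- t * \<sigma> powr \<alpha> * norm \<eta> powr \<alpha>)"
      using assms unfolding gauss_def r2[symmetric] by simp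
  qed
  finally show ?thesis .
qed

text \<open>The inequality \<open>1 - u \<le> exp (- u)\<close> averaged over the Gaussian law,
  whose moment of order \<open>\<alpha>\<close> is \<open>K\<close>. As \<open>\<sigma>\<close>
  tends to 0 the test function tends to 1, and the average falls short of one by at most a multiple
  of \<open>\<sigma> powr \<alpha>\<close>.\<close>

lemma stable_kernel_gauss_ge:
  fixes t \<alpha> \<sigma> :: real
  assumes "0 < t" "0 < \<alpha>" "0 < \<sigma>"
  defines "K \<equiv> (\<integral>\<eta>. gauss (\<eta>::'a::euclidean_space) * norm \<eta> powr \<alpha> \<partial>lborel)"
  shows "1 - K * t * \<sigma> powr \<alpha> \<le> (\<integral>z. stable_kernel \<alpha> t z * exp (- (\<sigma> * norm (z::'a))\<^sup>2 / 2) \<partial>lborel)"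
proof -
  let ?u = "\<lambda>\<eta>::'a. t * \<sigma> powr \<alpha> * norm \<eta> powr \<alpha>"
  have one: "(\<integral>\<eta>. gauss (\<eta>::'a) \<partial>lborel) = 1"
    using gauss_fourier[of "0::'a"] by simp
  have int: "integrable lborel (\<lambda>\<eta>::'a. gauss \<eta> - t * \<sigma> powr \<alpha> * (gauss \<eta> * norm \<eta> powr \<alpha>))"
    by (intro Bochner_Integration.integrable_diff integrable_mult_right integrable_gauss integrable_gauss_powr assms)
  have "1 - K * t * \<sigma> powr \<alpha> = (\<integral>\<eta>. gauss (\<eta>::'a) - t * \<sigma> powr \<alpha> * (gauss \<eta> * norm \<eta> powr \<alpha>) \<partial>lborel)"
    unfolding K_def by (subst Bochner_Integration.integral_diff)
      (auto intro!: integrable_mult_right integrable_gauss integrable_gauss_powr assms simp: one)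
  also have "\<dots> \<le> (\<integral>\<eta>. gauss (\<eta>::'a) * exp (- t * \<sigma> powr \<alpha> * norm \<eta> powr \<alpha>) \<partial>lborel)"
  proof (rule integral_mono[OF int])
    show "integrable lborel (\<lambda>\<eta>::'a. gauss \<eta> * exp (- t * \<sigma> powr \<alpha> * norm \<eta> powr \<alpha>))"
      by (rule Bochner_Integration.integrable_bound[OF integrable_gauss])
         (use assms in \<open>auto simp: abs_mult mult_left_le\<close>)
    fix \<eta> :: 'a
    have "gauss \<eta> * (1 - ?u \<eta>) \<le> gauss \<eta> * exp (- ?u \<eta>)"
      using exp_ge_add_one_self[of "- ?u \<eta>"] gauss_pos[of \<eta>] by (intro mult_left_mono) auto
    thus "gauss \<eta> - t * \<sigma> powr \<alpha> * (gauss \<eta> * norm \<eta> powr \<alpha>) \<le> gauss \<eta> * exp (- t * \<sigma> powr \<alpha> * norm \<eta> powr \<alpha>)"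
      by (simp add: algebra_simps)
  qed
  finally show ?thesis unfolding stable_kernel_gauss[OF assms(1-3)] .
qed

text \<open>\<open>\<integral> k\<^sup>- e\<^sub>\<sigma> + \<integral> k\<^sup>+ (1 - e\<^sub>\<sigma>) = 1 - \<integral> k e\<^sub>\<sigma>\<close> is of order \<open>\<sigma>\<^sup>\<alpha>\<close> for the Gaussian \<open>e\<^sub>\<sigma>\<close>; the first
  summand gives positivity of the kernel as \<open>\<sigma> \<rightarrow> 0\<close>, the second one the tail estimate.\<close>

lemma
  fixes t \<alpha> :: real
  assumes "0 < t" "0 < \<alpha>"
    and mass: "(\<integral>\<^sup>+z. ennreal (stable_kernel \<alpha> t (z::'a::euclidean_space)) \<partial>lborel) = 1"
  defines "K \<equiv> (\<integral>\<eta>. gauss (\<eta>::'a) * norm \<eta> powr \<alpha> \<partial>lborel)"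
  shows stable_kernel_nonneg_of_mass: "0 \<le> stable_kernel \<alpha> t (z::'a)"
    and stable_kernel_tail_of_mass: "0 < R \<Longrightarrow>
      (\<integral>\<^sup>+z. indicator {z. R \<le> norm z} z * ennreal (stable_kernel \<alpha> t (z::'a)) \<partial>lborel)
        \<le> ennreal (3 * K * t * R powr - \<alpha>)"
proof -
  let ?k = "stable_kernel \<alpha> t :: 'a \<Rightarrow> real"
  define kp where "kp = (\<lambda>z. max (?k z) 0)"
  define kn where "kn = (\<lambda>z. max (- ?k z) 0)"
  let ?g = "\<lambda>\<sigma> (z::'a). exp (- (\<sigma> * norm z)\<^sup>2 / 2)"
  have [measurable]: "kp \<in> borel_measurable borel" "kn \<in> borel_measurable borel"
    unfolding kp_def kn_def by measurable
  have nn: "kp z \<ge> 0" "kn z \<ge> 0" for z by (auto simp: kp_def kn_def)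
  \<comment> \<open>Since \<open>ennreal\<close> sends negative numbers to 0, the hypothesis
    \<open>mass\<close> speaks about the positive part only.\<close>
  have kkp: "ennreal (?k z) = ennreal (kp z)" for z
    by (auto simp: kp_def max_def ennreal_neg)
  have mass': "(\<integral>\<^sup>+z. ennreal (kp z) \<partial>lborel) = ennreal 1"
    using mass unfolding kkp by simp
  have intkp: "integrable lborel kp" "(\<integral>z. kp z \<partial>lborel) = 1"
    using nn_integral_eq_integrable[THEN iffD1, OF _ _ _ mass'] nn by auto
  \<comment> \<open>Nothing controls the mass of the negative part yet, so integrability comes from
    the boundedness of the kernel and the Gaussian factor.\<close>
  have intk: "integrable lborel (\<lambda>z. ?k z * ?g \<sigma> z)" if "0 < \<sigma>" for \<sigma>
    by (rule Bochner_Integration.integrable_bound[OF integrable_mult_right[OF integrable_exp_neg_square[OF that], of "stable_kernel \<alpha> t (0::'a)"]])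
       (use stable_kernel_abs_le[OF assms(1,2)] in \<open>auto simp: abs_mult intro!: mult_right_mono order_trans[OF _ abs_ge_self]\<close>)
  have intkpg: "integrable lborel (\<lambda>z. kp z * ?g \<sigma> z)" if "0 < \<sigma>" for \<sigma>
    by (rule Bochner_Integration.integrable_bound[OF intkp(1)])
       (use nn in \<open>auto simp: abs_mult mult_left_le\<close>)
  have kn_eq: "kn z * ?g \<sigma> z = kp z * ?g \<sigma> z - ?k z * ?g \<sigma> z" for z \<sigma>
    by (simp add: kn_def kp_def max_def algebra_simps)
  have intkng: "integrable lborel (\<lambda>z. kn z * ?g \<sigma> z)" if "0 < \<sigma>" for \<sigma>
    unfolding kn_eq using that by (intro Bochner_Integration.integrable_diff intkpg intk)
  have intkp1: "integrable lborel (\<lambda>z. kp z * (1 - ?g \<sigma> z))" if "0 < \<sigma>" for \<sigma>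
    unfolding right_diff_distrib mult_1_right by (intro Bochner_Integration.integrable_diff intkpg intkp that)
  have key: "(\<integral>z. kn z * ?g \<sigma> z \<partial>lborel) + (\<integral>z. kp z * (1 - ?g \<sigma> z) \<partial>lborel) \<le> K * t * \<sigma> powr \<alpha>"
    if "0 < \<sigma>" for \<sigma>
  proof -
    have "(\<integral>z. kn z * ?g \<sigma> z \<partial>lborel) = (\<integral>z. kp z * ?g \<sigma> z \<partial>lborel) - (\<integral>z. ?k z * ?g \<sigma> z \<partial>lborel)"
      unfolding kn_eq using that by (intro Bochner_Integration.integral_diff intkpg intk)
    moreover have "(\<integral>z. kp z * (1 - ?g \<sigma> z) \<partial>lborel) = 1 - (\<integral>z. kp z * ?g \<sigma> z \<partial>lborel)"
      unfolding right_diff_distrib mult_1_right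
      using Bochner_Integration.integral_diff[OF intkp(1) intkpg[OF that]] intkp(2) by simp
    ultimately show ?thesis
      using stable_kernel_gauss_ge[OF assms(1,2) that, where 'a='a] unfolding K_def by linarith
  qed
  have nonneg1: "0 \<le> (\<integral>z. kn z * ?g \<sigma> z \<partial>lborel)" "0 \<le> (\<integral>z. kp z * (1 - ?g \<sigma> z) \<partial>lborel)" for \<sigma>
    using nn by (auto intro!: integral_nonneg_AE mult_nonneg_nonneg)

  \<comment> \<open>The Gaussian grows as \<open>\<sigma>\<close> decreases, so one fixed integral
    lies below every bound with \<open>\<sigma> \<le> 1\<close>; letting \<open>\<sigma>\<close>
    tend to 0 makes it vanish.\<close>
  have small: "(\<integral>z. kn z * ?g 1 z \<partial>lborel) \<le> K * t * \<sigma> powr \<alpha>" if "0 < \<sigma>" "\<sigma> \<le> 1" for \<sigma>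
  proof -
    have "(\<integral>z. kn z * ?g 1 z \<partial>lborel) \<le> (\<integral>z. kn z * ?g \<sigma> z \<partial>lborel)"
    proof (intro integral_mono intkng that mult_left_mono nn)
      fix z :: 'a
      have "(\<sigma> * norm z)\<^sup>2 \<le> (1 * norm z)\<^sup>2"
        using that by (intro power_mono mult_right_mono) auto
      thus "?g 1 z \<le> ?g \<sigma> z" by simp
    qed simp
    thus ?thesis using key[OF that(1)] nonneg1(2)[of \<sigma>] by linarith
  qed
  have "((\<lambda>\<sigma>. K * t * \<sigma> powr \<alpha>) \<longlongrightarrow> K * t * 0) (at_right 0)"
    using assms(2) by (intro tendsto_intros) real_asymp
  moreover have "eventually (\<lambda>\<sigma>. (\<integral>z. kn z * ?g 1 z \<partial>lborel) \<le> K * t * \<sigma> powr \<alpha>) (at_right 0)"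
    unfolding eventually_at_right_field by (rule exI[of _ 1]) (use small in auto)
  ultimately have "(\<integral>z. kn z * ?g 1 z \<partial>lborel) \<le> K * t * 0"
    by (intro tendsto_lowerbound) auto
  hence "(\<integral>z. kn z * ?g 1 z \<partial>lborel) = 0"
    using nonneg1(1)[of 1] by simp
  hence "AE z in lborel. kn z * ?g 1 z = 0"
    using integral_nonneg_eq_0_iff_AE[OF intkng[of 1]] nn by simp
  \<comment> \<open>Almost everywhere improves to everywhere: by continuity the set is closed, and a
    closed set of full measure is the whole space.\<close>
  hence "AE z in lborel. z \<in> {z. 0 \<le> ?k z}"
    by (auto simp: kn_def max_def elim!: eventually_mono split: if_splits)
  hence "AE z in lebesgue. z \<in> {z. 0 \<le> ?k z}"
    by (rule AE_completion)
  moreover have "closed {z. 0 \<le> ?k z}"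
    using isCont_stable_kernel[OF assms(1,2)] by (intro closed_Collect_le continuous_at_imp_continuous_on) auto
  ultimately show "0 \<le> ?k z"
    using mem_closed_if_AE_lebesgue[of "{z. 0 \<le> ?k z}" z] by simp

  assume R: "0 < R"
  \<comment> \<open>With \<open>\<sigma> = 1/R\<close> the Gaussian is at most
    \<open>exp (- (1/2))\<close>, hence at most 2/3, wherever \<open>R \<le> norm z\<close>. Its
    complement to 1 is then at least 1/3, which is the origin of the factor 3.\<close>
  have exph: "exp (- (1/2)) \<le> (2/3::real)"
  proof -
    have "1 + 1/2 \<le> exp (1/2 :: real)" by (rule exp_ge_add_one_self)
    thus ?thesis by (simp add: exp_minus field_simps)
  qed
  have "(\<integral>\<^sup>+z. indicator {z. R \<le> norm z} z * ennreal (?k z) \<partial>lborel)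
      \<le> (\<integral>\<^sup>+z. ennreal (3 * (kp z * (1 - ?g (1/R) z))) \<partial>lborel)"
  proof (rule nn_integral_mono)
    fix z :: 'a
    show "indicator {z. R \<le> norm z} z * ennreal (?k z) \<le> ennreal (3 * (kp z * (1 - ?g (1/R) z)))"
    proof (cases "R \<le> norm z")
      case True
      have "1 \<le> (1 / R * norm z)\<^sup>2" using True R by (simp add: field_simps)
      hence "?g (1/R) z \<le> exp (- (1/2))" by simp
      hence "?g (1/R) z \<le> 2/3" using exph by (rule order_trans)
      hence "1 \<le> 3 * (1 - ?g (1/R) z)" by (simp del: exp_le_cancel_iff)
      from mult_left_mono[OF this nn(1)[of z]] show ?thesis
        using True unfolding kkp by (auto intro!: ennreal_leI simp: mult_ac)
    qed auto
  qed
  also have "\<dots> = ennreal (\<integral>z. 3 * (kp z * (1 - ?g (1/R) z)) \<partial>lborel)"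
    using R nn by (intro nn_integral_eq_integral integrable_mult_right intkp1) auto
  also have "\<dots> \<le> ennreal (3 * (K * t * (1/R) powr \<alpha>))"
    using key[of "1/R"] nonneg1(1)[of "1/R"] R by (intro ennreal_leI) simp
  also have "3 * (K * t * (1/R) powr \<alpha>) = 3 * K * t * R powr - \<alpha>"
    using R by (simp add: powr_minus_divide powr_divide)
  finally show "(\<integral>\<^sup>+z. indicator {z. R \<le> norm z} z * ennreal (?k z) \<partial>lborel) \<le> ennreal (3 * K * t * R powr - \<alpha>)" .
qed

subsection \<open>The potential of the singular weight\<close>

text \<open>Dyadic shells: where \<open>norm z\<close> lies between
  \<open>\<rho> / 2 ^ Suc k\<close> and \<open>\<rho> / 2 ^ k\<close>, the weight is at most its
  value at the inner radius, and the shell is enlarged to the full ball. Because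
  \<open>\<alpha>\<close> is below the dimension, the resulting series is geometric with ratio
  \<open>2 powr (\<alpha> - d) < 1\<close>.\<close>

lemma nn_integral_norm_powr_ball:
  fixes \<alpha> :: real
  assumes "0 < \<alpha>" "\<alpha> < real DIM('a::euclidean_space)"
  obtains C where "0 \<le> C" and
    "\<And>\<rho>. 0 < \<rho> \<Longrightarrow> (\<integral>\<^sup>+z. indicator (ball 0 \<rho>) z * ennreal (norm (z::'a) powr - \<alpha>) \<partial>lborel)
        \<le> ennreal (C * \<rho> powr (real DIM('a) - \<alpha>))"
proof
  let ?d = "real DIM('a)"
  let ?V = "unit_ball_vol ?d"
  let ?q = "2 powr (\<alpha> - ?d) :: real"
  let ?C = "?V * 2 powr \<alpha> * (1 / (1 - ?q))"
  have q: "0 < ?q" "?q < 1" using assms by (auto simp: powr_less_one)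
  show "0 \<le> ?C" using q by simp
  fix \<rho> :: real assume \<rho>: "0 < \<rho>"
  have term_eq: "?V * (\<rho> / 2 ^ k) ^ DIM('a) * (\<rho> / 2 ^ Suc k) powr - \<alpha> =
      ?V * 2 powr \<alpha> * \<rho> powr (?d - \<alpha>) * ?q ^ k" for k
  proof -
    have "(\<rho> / 2 ^ k) ^ DIM('a) = \<rho> powr ?d * 2 powr (- ?d * k)"
      using \<rho> by (simp add: powr_realpow power_divide powr_minus_divide powr_powr[symmetric] power_mult[symmetric] mult.commute flip: powr_realpow)
    moreover have "(\<rho> / 2 ^ Suc k) powr - \<alpha> = \<rho> powr - \<alpha> * 2 powr (\<alpha> * (1 + k))"
    proof -
      have "(2::real) ^ Suc k = 2 powr (1 + k)" by (simp add: powr_add powr_realpow)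
      thus ?thesis using \<rho> by (simp add: powr_divide powr_powr powr_minus_divide mult.commute)
    qed
    moreover have "?q ^ k = 2 powr ((\<alpha> - ?d) * k)"
      by (simp add: powr_power mult.commute)
    ultimately show ?thesis
      by (simp add: algebra_simps powr_add powr_diff powr_minus_divide)
  qed
  have "(\<integral>\<^sup>+z. indicator (ball 0 \<rho>) z * ennreal (norm (z::'a) powr - \<alpha>) \<partial>lborel) \<le>
      (\<integral>\<^sup>+z. (\<Sum>k. ennreal ((\<rho> / 2 ^ Suc k) powr - \<alpha>) * indicator (ball (0::'a) (\<rho> / 2 ^ k)) z) \<partial>lborel)"
  proof (rule nn_integral_mono)
    fix z :: 'a
    let ?f = "\<lambda>k. ennreal ((\<rho> / 2 ^ Suc k) powr - \<alpha>) * indicator (ball (0::'a) (\<rho> / 2 ^ k)) z"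
    show "indicator (ball 0 \<rho>) z * ennreal (norm z powr - \<alpha>) \<le> (\<Sum>k. ?f k)"
    \<comment> \<open>In the other case the left side is 0, also at the origin, because
      \<open>0 powr - \<alpha> = 0\<close> by convention.\<close>
    proof (cases "z \<noteq> 0 \<and> norm z < \<rho>")
      case True
      obtain n where n: "\<rho> / norm z < 2 ^ n"
        using real_arch_pow[of 2] by auto
      hence ex: "\<exists>n. \<rho> / 2 ^ n \<le> norm z"
        using True by (intro exI[of _ n]) (auto simp: field_simps)
      \<comment> \<open>The first dyadic radius that does not exceed \<open>norm z\<close>. It is
        not the zeroth one because \<open>norm z < \<rho>\<close>, so its predecessor
        \<open>k\<close> names the shell of \<open>z\<close>.\<close>
      define m where "m = (LEAST n. \<rho> / 2 ^ n \<le> norm z)"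
      have m: "\<rho> / 2 ^ m \<le> norm z" unfolding m_def using ex by (rule LeastI_ex)
      hence "m \<noteq> 0" using True by (auto intro: ccontr)
      then obtain k where k: "m = Suc k" using not0_implies_Suc by auto
      have "norm z < \<rho> / 2 ^ k"
        using not_less_Least[of k "\<lambda>n. \<rho> / 2 ^ n \<le> norm z"] k unfolding m_def by auto
      moreover have "norm z powr - \<alpha> \<le> (\<rho> / 2 ^ Suc k) powr - \<alpha>"
        using m k \<rho> assms True by (intro powr_mono2') auto
      ultimately have "indicator (ball 0 \<rho>) z * ennreal (norm z powr - \<alpha>) \<le> ?f k"
        using True by (auto simp: intro!: ennreal_leI)
      also have "\<dots> \<le> (\<Sum>k. ?f k)"
      proof -
        have "f k \<le> suminf f" for f :: "nat \<Rightarrow> ennreal"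
          using sum_le_suminf[of f "{k}"] by simp
        thus ?thesis .
      qed
      finally show ?thesis .
    qed auto
  qed
  also have "\<dots> = (\<Sum>k. ennreal ((\<rho> / 2 ^ Suc k) powr - \<alpha>) * emeasure lborel (ball (0::'a) (\<rho> / 2 ^ k)))"
  proof -
    have "(\<integral>\<^sup>+z. (\<Sum>k. c k * indicator (A k) z) \<partial>lborel) = (\<Sum>k. c k * emeasure lborel (A k))"
      if [measurable]: "\<And>k. A k \<in> sets borel" for c :: "nat \<Rightarrow> ennreal" and A :: "nat \<Rightarrow> 'a set"
      by (subst nn_integral_suminf) (simp_all add: nn_integral_cmult_indicator)
    from this[of "\<lambda>k. ball 0 (\<rho> / 2 ^ k)" "\<lambda>k. ennreal ((\<rho> / 2 ^ Suc k) powr - \<alpha>)"] show ?thesis by simp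
  qed
  also have "\<dots> = (\<Sum>k. ennreal (?V * 2 powr \<alpha> * \<rho> powr (?d - \<alpha>) * ?q ^ k))"
  proof (rule suminf_cong)
    fix k
    have "emeasure lborel (ball (0::'a) (\<rho> / 2 ^ k)) = ennreal (?V * (\<rho> / 2 ^ k) ^ DIM('a))"
      using \<rho> by (intro emeasure_ball) auto
    thus "ennreal ((\<rho> / 2 ^ Suc k) powr - \<alpha>) * emeasure lborel (ball (0::'a) (\<rho> / 2 ^ k)) =
        ennreal (?V * 2 powr \<alpha> * \<rho> powr (?d - \<alpha>) * ?q ^ k)"
      unfolding term_eq[symmetric] by (simp add: ennreal_mult'[symmetric] mult_ac)
  qed
  also have "\<dots> = ennreal (?V * 2 powr \<alpha> * \<rho> powr (?d - \<alpha>) * (1 / (1 - ?q)))"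
    using q by (intro suminf_ennreal_eq sums_mult geometric_sums) auto
  finally show "(\<integral>\<^sup>+z. indicator (ball 0 \<rho>) z * ennreal (norm (z::'a) powr - \<alpha>) \<partial>lborel)
        \<le> ennreal (?C * \<rho> powr (?d - \<alpha>))"
    by (simp add: mult_ac)
qed

lemma integrable_powr_from_0:
  fixes a T :: real
  assumes "a > - 1"
  shows "integrable lborel (\<lambda>s. indicator {0<..<T} s * s powr a)"
proof (cases "T \<ge> 0")
  case True
  have "(\<lambda>s. s powr a) absolutely_integrable_on {0..T}"
    using integrable_on_powr_from_0[OF assms True] by (rule nonnegative_absolutely_integrable_1) auto
  hence "(\<lambda>s. s powr a) absolutely_integrable_on {0<..<T}"
    by (rule set_integrable_subset) auto
  thus ?thesis
    unfolding set_integrable_def by (subst (asm) integrable_completion) auto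
qed auto

text \<open>The logarithmic divergence of \<open>\<integral>\<integral> \<bar>z\<bar>\<^sup>-\<^sup>\<alpha> k(s, z - y) dz ds\<close> at \<open>s = 0\<close> that scaling alone would suggest is
  avoided by splitting at the radius \<open>s\<^bsup>3/(2\<alpha>)\<^esup>\<close>: inside, the kernel is bounded by its value at \<open>0\<close>,
  outside the tail estimate applies, and both contributions are integrable powers of \<open>s\<close>.\<close>

lemma stable_kernel_potential_bound:
  fixes \<alpha> \<delta> :: real
  assumes \<alpha>: "0 < \<alpha>" "\<alpha> < real DIM('a::euclidean_space)" and \<delta>: "0 < \<delta>"
    and mass: "\<And>s. 0 < s \<Longrightarrow> (\<integral>\<^sup>+z. ennreal (stable_kernel \<alpha> s (z::'a)) \<partial>lborel) = 1"
  obtains g :: "real \<Rightarrow> real" where "\<And>s. 0 \<le> g s"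
    and "\<And>T. integrable lborel (\<lambda>s. indicator {0<..<T} s * g s)"
    and "\<And>s y. 0 < s \<Longrightarrow> 2 * \<delta> \<le> norm y \<Longrightarrow>
      (\<integral>\<^sup>+z. ennreal (norm (z::'a) powr - \<alpha> * stable_kernel \<alpha> s (z - y)) \<partial>lborel) \<le> ennreal (g s)"
proof -
  let ?d = "real DIM('a)"
  obtain C where C: "0 \<le> C"
    "\<And>\<rho>. 0 < \<rho> \<Longrightarrow> (\<integral>\<^sup>+z. indicator (ball 0 \<rho>) z * ennreal (norm (z::'a) powr - \<alpha>) \<partial>lborel)
        \<le> ennreal (C * \<rho> powr (?d - \<alpha>))"
    using nn_integral_norm_powr_ball[OF \<alpha>] by blast
  define K where "K = (\<integral>\<eta>. gauss (\<eta>::'a) * norm \<eta> powr \<alpha> \<partial>lborel)"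
  have K: "0 \<le> K" unfolding K_def by (intro integral_nonneg_AE AE_I2 mult_nonneg_nonneg less_imp_le[OF gauss_pos]) auto
  define B where "B = stable_kernel \<alpha> 1 (0::'a)"
  have B: "0 \<le> B" unfolding B_def by (rule stable_kernel_0_nonneg)
  \<comment> \<open>One summand for each region of \<open>z\<close>: \<open>norm z\<close> at least
    \<open>\<delta>\<close>, below the splitting radius, and in between.\<close>
  define g where "g s = \<delta> powr - \<alpha> + B * C * s powr (?d / (2 * \<alpha>) - 3/2) + 3 * K * \<delta> powr - \<alpha> * s powr (- (1/2))" for s
  show thesis
  proof
    show "0 \<le> g s" for s unfolding g_def using B C K by simp
    have fin: "integrable lborel (indicat_real {0<..<T})" for T :: real
      by (intro integrable_real_indicator emeasure_bounded_finite)
         (auto intro: bounded_subset[OF bounded_closed_interval[of 0 T]])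
    \<comment> \<open>Equivalent to \<open>\<alpha> < d\<close>.\<close>
    have "?d / (2 * \<alpha>) - 3/2 > -1" using \<alpha> by (simp add: field_simps)
    hence "integrable lborel (\<lambda>s. \<delta> powr - \<alpha> * indicator {0<..<T} s
        + B * C * (indicator {0<..<T} s * s powr (?d / (2 * \<alpha>) - 3/2))
        + 3 * K * \<delta> powr - \<alpha> * (indicator {0<..<T} s * s powr (- (1/2))))" for T
      by (intro Bochner_Integration.integrable_add integrable_mult_right integrable_powr_from_0 fin) auto
    thus "integrable lborel (\<lambda>s. indicator {0<..<T} s * g s)" for T
      unfolding g_def by (simp add: algebra_simps)
    fix s :: real and y :: 'a assume s: "0 < s" and y: "2 * \<delta> \<le> norm y"
    note nonneg = stable_kernel_nonneg_of_mass[OF s \<alpha>(1) mass[OF s]]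
    \<comment> \<open>For the radius \<open>s powr \<kappa>\<close> the inner part is of order
      \<open>s powr (\<kappa> * (d - \<alpha>) - d / \<alpha>)\<close> and the outer part of order
      \<open>s powr (1 - \<kappa> * \<alpha>)\<close>. Both are integrable at 0 exactly when
      \<kappa> lies strictly between \<open>1 / \<alpha>\<close> and \<open>2 / \<alpha>\<close>;
      the midpoint is taken.\<close>
    define \<rho> where "\<rho> = s powr (3 / (2 * \<alpha>))"
    have \<rho>: "0 < \<rho>" using s by (simp add: \<rho>_def)
    let ?k = "\<lambda>z. stable_kernel \<alpha> s (z - y)"
    let ?M = "s powr (- ?d / \<alpha>) * B"
    let ?t = "\<lambda>z. indicator {z. \<delta> \<le> norm z} (z - y) * ennreal (?k z)"
    have "(\<integral>\<^sup>+z. ennreal (norm z powr - \<alpha> * ?k z) \<partial>lborel) \<le>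
      (\<integral>\<^sup>+z. ennreal (\<delta> powr - \<alpha>) * ennreal (?k z)
         + ennreal ?M * (indicator (ball 0 \<rho>) z * ennreal (norm z powr - \<alpha>))
         + ennreal (\<rho> powr - \<alpha>) * ?t z \<partial>lborel)"
    proof (rule nn_integral_mono)
      fix z :: 'a
      consider "\<delta> \<le> norm z" | "norm z < \<rho>" | "norm z < \<delta>" "\<rho> \<le> norm z" by linarith
      thus "ennreal (norm z powr - \<alpha> * ?k z) \<le> ennreal (\<delta> powr - \<alpha>) * ennreal (?k z)
         + ennreal ?M * (indicator (ball 0 \<rho>) z * ennreal (norm z powr - \<alpha>))
         + ennreal (\<rho> powr - \<alpha>) * ?t z"
      proof cases
        case 1
        hence "norm z powr - \<alpha> * ?k z \<le> \<delta> powr - \<alpha> * ?k z"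
          using \<delta> \<alpha> nonneg by (intro mult_right_mono powr_mono2') auto
        hence "ennreal (norm z powr - \<alpha> * ?k z) \<le> ennreal (\<delta> powr - \<alpha>) * ennreal (?k z)"
          by (simp add: ennreal_mult'[symmetric] ennreal_leI)
        thus ?thesis by (meson add_increasing2 zero_le order_trans)
      next
        case 2
        have "?k z \<le> ?M"
          using stable_kernel_abs_le[OF s \<alpha>(1), of "z - y"] stable_kernel_scale_0[OF s \<alpha>(1), where 'a='a]
          unfolding B_def by linarith
        hence "norm z powr - \<alpha> * ?k z \<le> ?M * norm z powr - \<alpha>"
          by (metis mult.commute mult_left_mono powr_ge_zero)
        hence "ennreal (norm z powr - \<alpha> * ?k z) \<le> ennreal ?M * (indicator (ball 0 \<rho>) z * ennreal (norm z powr - \<alpha>))"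
          using 2 B by (simp add: ennreal_mult[symmetric] ennreal_leI)
        thus ?thesis by (meson add_increasing2 add_increasing zero_le order_trans)
      next
        case 3
        \<comment> \<open>A point within \<open>\<delta>\<close> of the origin is at distance at
          least \<open>\<delta>\<close> from \<open>y\<close>, so the tail estimate applies to the
          kernel there.\<close>
        have "\<delta> \<le> norm (z - y)"
          using norm_triangle_ineq2[of y z] y 3 by (simp add: norm_minus_commute)
        moreover have "norm z powr - \<alpha> * ?k z \<le> \<rho> powr - \<alpha> * ?k z"
          using \<rho> 3 \<alpha> nonneg by (intro mult_right_mono powr_mono2') auto
        ultimately have "ennreal (norm z powr - \<alpha> * ?k z) \<le> ennreal (\<rho> powr - \<alpha>) * ?t z"
          by (simp add: ennreal_mult'[symmetric] ennreal_leI)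
        thus ?thesis by (meson add_increasing zero_le order_trans)
      qed
    qed
    also have "\<dots> = ennreal (\<delta> powr - \<alpha>) * (\<integral>\<^sup>+z. ennreal (?k z) \<partial>lborel)
       + ennreal ?M * (\<integral>\<^sup>+z. indicator (ball 0 \<rho>) z * ennreal (norm (z::'a) powr - \<alpha>) \<partial>lborel)
       + ennreal (\<rho> powr - \<alpha>) * (\<integral>\<^sup>+z. ?t z \<partial>lborel)"
    proof -
      have lin: "(\<integral>\<^sup>+z. a * u z + b * v z + c * w z \<partial>lborel) =
          a * (\<integral>\<^sup>+z. u z \<partial>lborel) + b * (\<integral>\<^sup>+z. v z \<partial>lborel) + c * (\<integral>\<^sup>+z. w z \<partial>lborel)"
        if [measurable]: "u \<in> borel_measurable borel" "v \<in> borel_measurable borel" "w \<in> borel_measurable borel"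
        for a b c :: ennreal and u v w :: "'a \<Rightarrow> ennreal"
        by (simp add: nn_integral_add nn_integral_cmult)
      have "(\<lambda>z. ?t z) \<in> borel_measurable borel"
        by measurable
      moreover have "(\<lambda>z::'a. indicator (ball 0 \<rho>) z * ennreal (norm z powr - \<alpha>)) \<in> borel_measurable borel"
        by (intro borel_measurable_times_ennreal borel_measurable_indicator) auto
      ultimately show ?thesis by (intro lin) auto
    qed
    also have "(\<integral>\<^sup>+z. ennreal (?k z) \<partial>lborel) = 1"
      using nn_integral_lborel_translate[of "\<lambda>z. ennreal (stable_kernel \<alpha> s z)" y] mass[OF s] by simp
    also have "(\<integral>\<^sup>+z. ?t z \<partial>lborel) =
        (\<integral>\<^sup>+z. indicator {z. \<delta> \<le> norm z} z * ennreal (stable_kernel \<alpha> s (z::'a)) \<partial>lborel)"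
      by (rule nn_integral_lborel_translate) measurable
    also have "ennreal (\<delta> powr - \<alpha>) * 1
       + ennreal ?M * (\<integral>\<^sup>+z. indicator (ball 0 \<rho>) z * ennreal (norm (z::'a) powr - \<alpha>) \<partial>lborel)
       + ennreal (\<rho> powr - \<alpha>) * \<dots> \<le>
       ennreal (\<delta> powr - \<alpha>) * 1
       + ennreal ?M * ennreal (C * \<rho> powr (?d - \<alpha>))
       + ennreal (\<rho> powr - \<alpha>) * ennreal (3 * K * s * \<delta> powr - \<alpha>)"
      using stable_kernel_tail_of_mass[OF s \<alpha>(1) mass[OF s] \<delta>] C(2)[OF \<rho>] unfolding K_def
      by (intro add_mono mult_left_mono order_refl) auto
    also have "\<dots> = ennreal (\<delta> powr - \<alpha> + ?M * (C * \<rho> powr (?d - \<alpha>)) + \<rho> powr - \<alpha> * (3 * K * s * \<delta> powr - \<alpha>))"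
      using B C K s by (simp add: ennreal_mult[symmetric] ennreal_plus[symmetric] del: ennreal_plus)
    also have "\<dots> = ennreal (g s)"
    proof -
      have "?M * (C * \<rho> powr (?d - \<alpha>)) = B * C * s powr (?d / (2 * \<alpha>) - 3/2)"
      proof -
        have "- ?d / \<alpha> + 3 / (2 * \<alpha>) * (?d - \<alpha>) = ?d / (2 * \<alpha>) - 3/2"
          using \<alpha> by (simp add: field_simps)
        thus ?thesis unfolding \<rho>_def powr_powr by (simp add: powr_add[symmetric])
      qed
      moreover have "\<rho> powr - \<alpha> * (3 * K * s * \<delta> powr - \<alpha>) = 3 * K * \<delta> powr - \<alpha> * s powr (- (1/2))"
      proof -
        have "s powr (3 / (2 * \<alpha>) * - \<alpha>) * s powr 1 = s powr (- (1/2))"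
          unfolding powr_add[symmetric] using \<alpha> by simp
        hence h: "s powr (3 / (2 * \<alpha>) * - \<alpha>) * s = s powr (- (1/2))" using s by simp
        have "r * (3 * K * s * e) = 3 * K * e * (r * s)" for r e by simp
        thus ?thesis unfolding \<rho>_def powr_powr h[symmetric] .
      qed
      ultimately show ?thesis unfolding g_def by (simp only:)
    qed
    finally show "(\<integral>\<^sup>+z. ennreal (norm (z::'a) powr - \<alpha> * ?k z) \<partial>lborel) \<le> ennreal (g s)" .
  qed
qed

subsection \<open>Finiteness and continuity of the first perturbation term\<close>

context
  fixes \<alpha> t :: real and x :: "'a::euclidean_space"
  assumes \<alpha>: "0 < \<alpha>" "\<alpha> < real DIM('a)" and t: "0 < t"
    and mass: "\<And>s. 0 < s \<Longrightarrow> (\<integral>\<^sup>+z. ennreal (stable_kernel \<alpha> s (z::'a)) \<partial>lborel) = 1"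
begin

abbreviation p1_integrand :: "real \<Rightarrow> 'a \<Rightarrow> 'a \<Rightarrow> real" where
  "p1_integrand s y z \<equiv> stable_kernel \<alpha> (t - s) (x - z) * norm z powr - \<alpha> * stable_kernel \<alpha> s (z - y)"

lemma kernel_nonneg: "0 < s \<Longrightarrow> 0 \<le> stable_kernel \<alpha> s (z::'a)"
  using stable_kernel_nonneg_of_mass[OF _ \<alpha>(1) mass] by blast

lemma p1_integrand_nonneg:
  fixes s :: real and y z :: 'a
  shows "0 < s \<Longrightarrow> s < t \<Longrightarrow> 0 \<le> p1_integrand s y z"
  by (intro mult_nonneg_nonneg kernel_nonneg) auto

text \<open>At every \<open>s\<close> one of the two kernels runs for a time of at least
  \<open>t / 2\<close> and is bounded by a constant; the other one, together with the weight, is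
  covered by \<open>stable_kernel_potential_bound\<close>. The majorant is uniform in
  \<open>y\<close> away from the origin, as dominated convergence in \<open>s\<close> requires. The
  last conclusion provides the majorant in \<open>z\<close> at fixed \<open>s\<close>.\<close>

lemma p1_integrand_bound:
  assumes \<delta>: "0 < \<delta>" and x: "2 * \<delta> \<le> norm x"
  obtains G :: "real \<Rightarrow> real"
  where "integrable lborel (\<lambda>s. indicator {0<..<t} s * G s)" "\<And>s. 0 \<le> G s"
    and "\<And>s y. 0 < s \<Longrightarrow> s < t \<Longrightarrow> 2 * \<delta> \<le> norm y \<Longrightarrow>
      (\<integral>\<^sup>+z. ennreal (p1_integrand s y z) \<partial>lborel) \<le> ennreal (G s)"
    and "\<And>s. 0 < s \<Longrightarrow> s < t \<Longrightarrow> integrable lborel (\<lambda>z. stable_kernel \<alpha> (t - s) (x - z) * norm z powr - \<alpha>)"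
proof -
  obtain g :: "real \<Rightarrow> real" where g: "\<And>s. 0 \<le> g s"
    "\<And>T. integrable lborel (\<lambda>s. indicator {0<..<T} s * g s)"
    "\<And>s y. 0 < s \<Longrightarrow> 2 * \<delta> \<le> norm y \<Longrightarrow>
      (\<integral>\<^sup>+z. ennreal (norm (z::'a) powr - \<alpha> * stable_kernel \<alpha> s (z - y)) \<partial>lborel) \<le> ennreal (g s)"
    using stable_kernel_potential_bound[OF \<alpha> \<delta> mass] by blast
  define B where "B = (t/2) powr (- real DIM('a) / \<alpha>) * stable_kernel \<alpha> 1 (0::'a)"
  have B: "0 \<le> B" by (simp add: B_def stable_kernel_0_nonneg)
  have kB: "stable_kernel \<alpha> r z \<le> B" if "t / 2 \<le> r" for r and z :: 'a
  proof -
    have r: "0 < r" using that t by linarith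
    have "stable_kernel \<alpha> r z \<le> r powr (- real DIM('a) / \<alpha>) * stable_kernel \<alpha> 1 (0::'a)"
      using stable_kernel_abs_le[OF r \<alpha>(1), of z] stable_kernel_scale_0[OF r \<alpha>(1), where 'a='a] by linarith
    also have "\<dots> \<le> B"
      unfolding B_def using that t \<alpha> by (intro mult_right_mono powr_mono2' stable_kernel_0_nonneg) auto
    finally show ?thesis .
  qed
  show thesis
  proof
    \<comment> \<open>The reflection of \<open>s\<close> to \<open>t - s\<close> maps the interval
      to itself and moves the singularity of \<open>g\<close> from 0 to \<open>t\<close>.\<close>
    have "integrable lborel (\<lambda>s. indicator {0<..<t} (t + - 1 * s) * g (t + - 1 * s))"
      using g(2)[of t] by (rule lborel_integrable_real_affine) simp
    moreover have "indicator {0<..<t} (t + - 1 * s) = (indicator {0<..<t} s :: real)" for s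
      by (auto simp: indicator_def)
    ultimately have "integrable lborel (\<lambda>s. indicator {0<..<t} s * g (t - s))" by simp
    hence "integrable lborel (\<lambda>s. B * (indicator {0<..<t} s * g s + indicator {0<..<t} s * g (t - s)))"
      by (intro integrable_mult_right Bochner_Integration.integrable_add g)
    thus "integrable lborel (\<lambda>s. indicator {0<..<t} s * (B * (g s + g (t - s))))"
      by (simp add: algebra_simps)
    show "0 \<le> B * (g s + g (t - s))" for s using B g(1) by simp
    have gx: "(\<integral>\<^sup>+z. ennreal (stable_kernel \<alpha> (t - s) (x - z) * norm z powr - \<alpha>) \<partial>lborel) \<le> ennreal (g (t - s))"
      if "s < t" for s
      using g(3)[of "t - s" x] that x by (simp add: stable_kernel_minus_commute[of _ _ x] mult.commute)
    show "(\<integral>\<^sup>+z. ennreal (p1_integrand s y z) \<partial>lborel) \<le> ennreal (B * (g s + g (t - s)))"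
      if s: "0 < s" "s < t" and y: "2 * \<delta> \<le> norm y" for s y
    proof (cases "s \<le> t / 2")
      case True
      have "(\<integral>\<^sup>+z. ennreal (p1_integrand s y z) \<partial>lborel) \<le>
          (\<integral>\<^sup>+z. ennreal B * ennreal (norm z powr - \<alpha> * stable_kernel \<alpha> s (z - y)) \<partial>lborel)"
      proof (rule nn_integral_mono)
        fix z :: 'a
        have "p1_integrand s y z \<le> B * (norm z powr - \<alpha> * stable_kernel \<alpha> s (z - y))"
          unfolding mult.assoc using True s by (intro mult_right_mono mult_nonneg_nonneg kB kernel_nonneg) auto
        thus "ennreal (p1_integrand s y z) \<le> ennreal B * ennreal (norm z powr - \<alpha> * stable_kernel \<alpha> s (z - y))"
          using B by (simp add: ennreal_mult'[symmetric] ennreal_leI)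
      qed
      also have "\<dots> = ennreal B * (\<integral>\<^sup>+z. ennreal (norm z powr - \<alpha> * stable_kernel \<alpha> s (z - y)) \<partial>lborel)"
        by (rule nn_integral_cmult) measurable
      also have "\<dots> \<le> ennreal B * ennreal (g s)"
        using g(3)[OF s(1) y] by (rule mult_left_mono) simp
      also have "\<dots> = ennreal (B * g s)" using B by (simp add: ennreal_mult')
      also have "\<dots> \<le> ennreal (B * (g s + g (t - s)))"
        using B g(1) by (intro ennreal_leI mult_left_mono) auto
      finally show ?thesis .
    next
      case False
      have "(\<integral>\<^sup>+z. ennreal (p1_integrand s y z) \<partial>lborel) \<le>
          (\<integral>\<^sup>+z. ennreal B * ennreal (stable_kernel \<alpha> (t - s) (x - z) * norm z powr - \<alpha>) \<partial>lborel)"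
      proof (rule nn_integral_mono)
        fix z :: 'a
        have "p1_integrand s y z \<le> stable_kernel \<alpha> (t - s) (x - z) * norm z powr - \<alpha> * B"
          using False s by (intro mult_left_mono mult_nonneg_nonneg kB kernel_nonneg) auto
        thus "ennreal (p1_integrand s y z) \<le> ennreal B * ennreal (stable_kernel \<alpha> (t - s) (x - z) * norm z powr - \<alpha>)"
          using B by (simp add: ennreal_mult'[symmetric] ennreal_leI mult_ac)
      qed
      also have "\<dots> = ennreal B * (\<integral>\<^sup>+z. ennreal (stable_kernel \<alpha> (t - s) (x - z) * norm z powr - \<alpha>) \<partial>lborel)"
        by (rule nn_integral_cmult) measurable
      also have "\<dots> \<le> ennreal B * ennreal (g (t - s))"
        using gx[OF s(2)] by (rule mult_left_mono) simp
      also have "\<dots> = ennreal (B * g (t - s))" using B by (simp add: ennreal_mult')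
      also have "\<dots> \<le> ennreal (B * (g s + g (t - s)))"
        using B g(1) by (intro ennreal_leI mult_left_mono) auto
      finally show ?thesis .
    qed
    show "integrable lborel (\<lambda>z. stable_kernel \<alpha> (t - s) (x - z) * norm z powr - \<alpha>)"
      if s: "0 < s" "s < t" for s
    proof (rule integrableI_nonneg)
      show "(\<integral>\<^sup>+z. ennreal (stable_kernel \<alpha> (t - s) (x - z) * norm z powr - \<alpha>) \<partial>lborel) < \<infinity>"
        using gx[OF s(2)] by (rule le_less_trans) simp
      show "AE z in lborel. 0 \<le> stable_kernel \<alpha> (t - s) (x - z) * norm z powr - \<alpha>"
        using s by (intro AE_I2 mult_nonneg_nonneg kernel_nonneg) auto
    qed measurable
  qed
qed

text \<open>Dominated convergence at two levels: in \<open>z\<close> at fixed \<open>s\<close>, then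
  in \<open>s\<close>. The identity \<open>ennreal_p1\<close> certifies that \<open>p1\<close> is
  the genuine iterated integral and not the default value of a divergent one.\<close>

lemma
  assumes x: "x \<noteq> 0" and y: "y \<noteq> 0"
  shows isCont_p1: "isCont (p1 \<alpha> t x) y"
    and ennreal_p1: "ennreal (p1 \<alpha> t x y) =
      (\<integral>\<^sup>+s. indicator {0<..<t} s * (\<integral>\<^sup>+z. ennreal (p1_integrand s y z) \<partial>lborel) \<partial>lborel)"
    and p1_nonneg: "0 \<le> p1 \<alpha> t x y"
proof -
  \<comment> \<open>The division by 4 makes \<open>2 * \<delta> < norm y\<close> strict, so that
    \<open>y\<close> is an interior point of the region on which the majorant is valid.\<close>
  define \<delta> where "\<delta> = min (norm x) (norm y) / 4"
  have "0 < norm x" "0 < norm y" using x y by simp_all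
  hence \<delta>: "0 < \<delta>" "2 * \<delta> \<le> norm x" "2 * \<delta> < norm y"
    unfolding \<delta>_def by linarith+
  obtain G :: "real \<Rightarrow> real" where G: "integrable lborel (\<lambda>s. indicator {0<..<t} s * G s)" "\<And>s. 0 \<le> G s"
    and hG: "\<And>s y. 0 < s \<Longrightarrow> s < t \<Longrightarrow> 2 * \<delta> \<le> norm y \<Longrightarrow>
      (\<integral>\<^sup>+z. ennreal (p1_integrand s y z) \<partial>lborel) \<le> ennreal (G s)"
    and W: "\<And>s. 0 < s \<Longrightarrow> s < t \<Longrightarrow> integrable lborel (\<lambda>z. stable_kernel \<alpha> (t - s) (x - z) * norm z powr - \<alpha>)"
    using p1_integrand_bound[OF \<delta>(1,2)] by blast
  let ?F = "\<lambda>s y. \<integral>z. p1_integrand s y z \<partial>lborel"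
  \<comment> \<open>The last kernel is replaced by its maximum. That maximum blows up as
    \<open>s\<close> tends to 0, so this majorant serves only at fixed \<open>s\<close>.\<close>
  have W': "integrable lborel (\<lambda>z. stable_kernel \<alpha> (t - s) (x - z) * norm z powr - \<alpha> * stable_kernel \<alpha> s (0::'a))"
    if "0 < s" "s < t" for s
    using W[OF that] by (rule integrable_mult_left)
  have le: "norm (p1_integrand s y z) \<le> stable_kernel \<alpha> (t - s) (x - z) * norm z powr - \<alpha> * stable_kernel \<alpha> s (0::'a)"
    if "0 < s" "s < t" for s y z
  proof -
    have "stable_kernel \<alpha> s (z - y) \<le> stable_kernel \<alpha> s (0::'a)"
      using stable_kernel_abs_le[OF that(1) \<alpha>(1), of "z - y"] by linarith
    hence "p1_integrand s y z \<le> stable_kernel \<alpha> (t - s) (x - z) * norm z powr - \<alpha> * stable_kernel \<alpha> s (0::'a)"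
      using that by (intro mult_left_mono mult_nonneg_nonneg kernel_nonneg) auto
    thus ?thesis using p1_integrand_nonneg[OF that, where y = y and z = z] by simp
  qed
  have hint: "integrable lborel (p1_integrand s y)" if "0 < s" "s < t" for s y
  proof (rule Bochner_Integration.integrable_bound[OF W'[OF that]])
    show "AE z in lborel. norm (p1_integrand s y z) \<le>
        norm (stable_kernel \<alpha> (t - s) (x - z) * norm z powr - \<alpha> * stable_kernel \<alpha> s (0::'a))"
      using le[OF that] by (intro AE_I2) (auto intro: order_trans[OF _ abs_ge_self])
  qed measurable
  have hnn: "(\<integral>\<^sup>+z. ennreal (p1_integrand s y z) \<partial>lborel) = ennreal (?F s y)" if "0 < s" "s < t" for s y
    using hint[OF that] p1_integrand_nonneg[OF that] by (intro nn_integral_eq_integral AE_I2) auto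
  have F0: "0 \<le> ?F s y" if "0 < s" "s < t" for s y
    using p1_integrand_nonneg[OF that] by (intro integral_nonneg_AE AE_I2) auto
  have FG: "?F s y \<le> G s" if "0 < s" "s < t" "2 * \<delta> \<le> norm y" for s y
    using hG[OF that] G(2) unfolding hnn[OF that(1,2)] by simp
  have Fcont: "(\<lambda>n. ?F s (u n)) \<longlonglongrightarrow> ?F s w" if s: "0 < s" "s < t" and u: "u \<longlonglongrightarrow> w" for s u w
  proof (rule integral_dominated_convergence[OF _ _ W'[OF s]])
    have "(\<lambda>n. stable_kernel \<alpha> s (z - u n)) \<longlonglongrightarrow> stable_kernel \<alpha> s (z - w)" for z
      using isCont_tendsto_compose[OF isCont_stable_kernel[OF s(1) \<alpha>(1), of "z - w"] tendsto_diff[OF tendsto_const u]] .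
    thus "AE z in lborel. (\<lambda>n. p1_integrand s (u n) z) \<longlonglongrightarrow> p1_integrand s w z"
      by (intro AE_I2 tendsto_mult tendsto_const)
    show "AE z in lborel. norm (p1_integrand s (u n) z) \<le>
        stable_kernel \<alpha> (t - s) (x - z) * norm z powr - \<alpha> * stable_kernel \<alpha> s (0::'a)" for n
      using le[OF s] by (intro AE_I2)
  qed measurable
  have Fm: "(\<lambda>s. indicator {0<..<t} s * ?F s y) \<in> borel_measurable lborel" for y
    by measurable
  have FG': "norm (indicator {0<..<t} s * ?F s y) \<le> indicator {0<..<t} s * G s" if "2 * \<delta> \<le> norm y" for s y
    using FG[OF _ _ that, of s] F0[of s y] by (auto simp: indicator_def)
  have Fint: "integrable lborel (\<lambda>s. indicator {0<..<t} s * ?F s y)" if "2 * \<delta> \<le> norm y" for y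
  proof (rule Bochner_Integration.integrable_bound[OF G(1) Fm])
    show "AE s in lborel. norm (indicator {0<..<t} s * ?F s y) \<le> norm (indicator {0<..<t} s * G s)"
      using FG'[OF that] by (intro AE_I2) (auto intro: order_trans[OF _ abs_ge_self])
  qed
  have "continuous_on {y. 2 * \<delta> < norm y} (p1 \<alpha> t x)"
    unfolding continuous_on_sequentially
  proof (intro allI ballI impI, elim conjE)
    fix u and w :: 'a
    assume w: "w \<in> {y. 2 * \<delta> < norm y}" and uS: "\<forall>n. u n \<in> {y. 2 * \<delta> < norm y}" and u: "u \<longlonglongrightarrow> w"
    have "(\<lambda>n. \<integral>s. indicator {0<..<t} s * ?F s (u n) \<partial>lborel) \<longlonglongrightarrow> (\<integral>s. indicator {0<..<t} s * ?F s w \<partial>lborel)"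
    proof (rule integral_dominated_convergence[OF Fm Fm G(1)])
      show "AE s in lborel. (\<lambda>n. indicator {0<..<t} s * ?F s (u n)) \<longlonglongrightarrow> indicator {0<..<t} s * ?F s w"
        using Fcont[OF _ _ u] by (intro AE_I2) (auto simp: indicator_def)
      show "AE s in lborel. norm (indicator {0<..<t} s * ?F s (u n)) \<le> indicator {0<..<t} s * G s" for n
        using uS by (intro AE_I2 FG') (auto intro: less_imp_le)
    qed
    thus "(p1 \<alpha> t x \<circ> u) \<longlonglongrightarrow> p1 \<alpha> t x w"
      by (simp add: p1_def o_def)
  qed
  moreover have "open {y::'a. 2 * \<delta> < norm y}"
    by (intro open_Collect_less continuous_intros)
  ultimately show "isCont (p1 \<alpha> t x) y"
    using \<delta>(3) by (simp add: continuous_on_eq_continuous_at)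
  have nn: "0 \<le> indicator {0<..<t} s * ?F s y" for s
    using F0[of s y] by (auto simp: indicator_def)
  show "0 \<le> p1 \<alpha> t x y"
    unfolding p1_def using nn by (intro integral_nonneg_AE AE_I2)
  have "ennreal (p1 \<alpha> t x y) = (\<integral>\<^sup>+s. ennreal (indicator {0<..<t} s * ?F s y) \<partial>lborel)"
    unfolding p1_def using \<delta>(3) nn by (intro nn_integral_eq_integral[symmetric] Fint AE_I2) auto
  also have "\<dots> = (\<integral>\<^sup>+s. indicator {0<..<t} s * (\<integral>\<^sup>+z. ennreal (p1_integrand s y z) \<partial>lborel) \<partial>lborel)"
    by (intro nn_integral_cong) (auto simp: indicator_def hnn)
  finally show "ennreal (p1 \<alpha> t x y) =
      (\<integral>\<^sup>+s. indicator {0<..<t} s * (\<integral>\<^sup>+z. ennreal (p1_integrand s y z) \<partial>lborel) \<partial>lborel)" .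
qed

end

subsection \<open>The Feynman--Kac density\<close>

context
  fixes \<alpha> :: real and M :: "'b measure" and X :: "real \<Rightarrow> 'b \<Rightarrow> 'a::euclidean_space" and x :: 'a
  assumes proc: "stable_process \<alpha> M X x"
begin

interpretation prob_space M
  using proc by (simp add: stable_process_def)

lemma process_measurable_pair: "(\<lambda>(s, \<omega>). X s \<omega>) \<in> borel_measurable (lborel \<Otimes>\<^sub>M M)"
  using proc by (simp add: stable_process_def)

lemma process_measurable:
  assumes "f \<in> borel_measurable N" "g \<in> measurable N M"
  shows "(\<lambda>w. X (f w) (g w)) \<in> borel_measurable N"
proof -
  have "(\<lambda>w. (f w, g w)) \<in> measurable N (lborel \<Otimes>\<^sub>M M)" using assms by simp
  from measurable_compose[OF this process_measurable_pair] show ?thesis by simp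
qed

lemma process_start: "AE \<omega> in M. X 0 \<omega> = x"
  using proc by (simp add: stable_process_def)

lemma increment_distributed:
  assumes "0 \<le> s" "s < u"
  shows "distributed M lborel (\<lambda>\<omega>. X u \<omega> - X s \<omega>) (\<lambda>z. ennreal (stable_kernel \<alpha> (u - s) z))"
proof -
  \<comment> \<open>\<open>stable_process\<close> speaks about infinite strictly increasing time
    sequences that start at 0, so the pair \<open>s\<close>, \<open>u\<close> is embedded in one.
    The increment has index 0 if \<open>s = 0\<close> and index 1 otherwise.\<close>
  define \<sigma> :: "nat \<Rightarrow> real" where "\<sigma> = (if s = 0 then (\<lambda>i. real i * u) else
    case_nat 0 (\<lambda>i. s + real i * (u - s)))"
  have "\<sigma> 0 = 0" by (simp add: \<sigma>_def)
  moreover have "strict_mono \<sigma>"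
    unfolding strict_mono_Suc_iff using assms by (auto simp: \<sigma>_def algebra_simps split: nat.split)
  ultimately have "distributed M lborel (\<lambda>\<omega>. X (\<sigma> (Suc i)) \<omega> - X (\<sigma> i) \<omega>)
      (\<lambda>z. ennreal (stable_kernel \<alpha> (\<sigma> (Suc i) - \<sigma> i) z))" for i
    using proc by (auto simp: stable_process_def)
  from this[of "if s = 0 then 0 else 1"] show ?thesis
    by (auto simp: \<sigma>_def split: if_splits)
qed

lemma increments_indep:
  assumes "0 < s" "s < u"
  shows "indep_var lborel (\<lambda>\<omega>. X s \<omega> - X 0 \<omega>) lborel (\<lambda>\<omega>. X u \<omega> - X s \<omega>)"
proof -
  define \<sigma> :: "nat \<Rightarrow> real" where "\<sigma> = case_nat 0 (\<lambda>i. s + real i * (u - s))"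
  let ?D = "\<lambda>i \<omega>. X (\<sigma> (Suc i)) \<omega> - X (\<sigma> i) \<omega>"
  have "\<sigma> 0 = 0" by (simp add: \<sigma>_def)
  moreover have "strict_mono \<sigma>"
    unfolding strict_mono_Suc_iff using assms by (auto simp: \<sigma>_def algebra_simps split: nat.split)
  ultimately have "indep_vars (\<lambda>_. borel) ?D {..<2}"
    using proc by (auto simp: stable_process_def)
  hence "indep_var (PiM {0} (\<lambda>_. borel)) (\<lambda>\<omega>. restrict (\<lambda>i. ?D i \<omega>) {0})
      (PiM {1} (\<lambda>_. borel)) (\<lambda>\<omega>. restrict (\<lambda>i. ?D i \<omega>) {1})"
    by (rule indep_var_restrict) auto
  hence "indep_var lborel ((\<lambda>f. f 0) \<circ> (\<lambda>\<omega>. restrict (\<lambda>i. ?D i \<omega>) {0}))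
      lborel ((\<lambda>f. f 1) \<circ> (\<lambda>\<omega>. restrict (\<lambda>i. ?D i \<omega>) {1}))"
    by (rule indep_var_compose) (auto intro: measurable_component_singleton)
  thus ?thesis by (simp add: o_def \<sigma>_def)
qed

text \<open>The density of a probability law integrates to one; this discharges the hypothesis
  \<open>mass\<close> of the kernel estimates.\<close>

lemma process_mass:
  assumes "0 < s"
  shows "(\<integral>\<^sup>+z. ennreal (stable_kernel \<alpha> s (z::'a)) \<partial>lborel) = 1"
  using distributed_nn_integral[OF increment_distributed[of 0 s], of "\<lambda>_. 1"] assms
  by (simp add: emeasure_space_1)

lemma one_time_law:
  assumes "0 < t" and [measurable]: "A \<in> sets borel"
  shows "(\<integral>\<^sup>+\<omega>. indicator A (X t \<omega>) \<partial>M) = (\<integral>\<^sup>+y. indicator A y * ennreal (stable_kernel \<alpha> t (x - y)) \<partial>lborel)"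
proof -
  have "(\<integral>\<^sup>+\<omega>. indicator A (X t \<omega>) \<partial>M) = (\<integral>\<^sup>+\<omega>. indicator A (x + (X t \<omega> - X 0 \<omega>)) \<partial>M)"
    using process_start by (intro nn_integral_cong_AE) (auto elim!: eventually_mono)
  also have "\<dots> = (\<integral>\<^sup>+z. ennreal (stable_kernel \<alpha> t z) * indicator A (x + z) \<partial>lborel)"
    using distributed_nn_integral[OF increment_distributed[of 0 t], of "\<lambda>z. indicator A (x + z)"] assms by simp
  also have "\<dots> = (\<integral>\<^sup>+y. ennreal (stable_kernel \<alpha> t (y - x)) * indicator A (x + (y - x)) \<partial>lborel)"
    by (rule nn_integral_lborel_translate[symmetric]) measurable
  finally show ?thesis
    by (simp add: stable_kernel_minus_commute[of _ _ x] mult.commute)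
qed

text \<open>The Markov property at time \<open>s\<close>: the two increments are independent, so
  their joint density is a product, and the substitutions \<open>z = x + u\<close>,
  \<open>y = z + v\<close> turn increments into positions. Nonnegativity of the kernel lets
  \<open>ennreal\<close> pass through the product.\<close>

lemma two_time_law:
  assumes "0 < s" "s < t" and [measurable]: "A \<in> sets borel"
    and nonneg: "\<And>r z. 0 < r \<Longrightarrow> 0 \<le> stable_kernel \<alpha> r (z::'a)"
  shows "(\<integral>\<^sup>+\<omega>. indicator A (X t \<omega>) * ennreal (norm (X s \<omega>) powr - \<alpha>) \<partial>M) =
    (\<integral>\<^sup>+y. indicator A y *
      (\<integral>\<^sup>+z. ennreal (stable_kernel \<alpha> s (x - z) * norm z powr - \<alpha> * stable_kernel \<alpha> (t - s) (z - y)) \<partial>lborel) \<partial>lborel)"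
proof -
  let ?\<phi> = "\<lambda>(u, v). indicator A (x + u + v) * ennreal (norm (x + u) powr - \<alpha>)"
  let ?k = "\<lambda>r (z::'a). ennreal (stable_kernel \<alpha> r z)"
  have joint: "distributed M (lborel \<Otimes>\<^sub>M lborel) (\<lambda>\<omega>. (X s \<omega> - X 0 \<omega>, X t \<omega> - X s \<omega>))
      (\<lambda>(u, v). ?k s u * ?k (t - s) v)"
    using increment_distributed[of 0 s] increment_distributed[of s t] increments_indep[of s t] assms(1,2)
    by (intro distributed_joint_indep) (auto intro: lborel.sigma_finite_measure_axioms)
  have \<phi>m: "?\<phi> \<in> borel_measurable (lborel \<Otimes>\<^sub>M lborel)" by measurable
  have "(\<integral>\<^sup>+\<omega>. indicator A (X t \<omega>) * ennreal (norm (X s \<omega>) powr - \<alpha>) \<partial>M) =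
      (\<integral>\<^sup>+\<omega>. ?\<phi> (X s \<omega> - X 0 \<omega>, X t \<omega> - X s \<omega>) \<partial>M)"
    using process_start by (intro nn_integral_cong_AE) (auto elim!: eventually_mono)
  also have "\<dots> = (\<integral>\<^sup>+w. (case w of (u, v) \<Rightarrow> ?k s u * ?k (t - s) v) * ?\<phi> w \<partial>(lborel \<Otimes>\<^sub>M lborel))"
    using distributed_nn_integral[OF joint \<phi>m] by simp
  also have "\<dots> = (\<integral>\<^sup>+u. (\<integral>\<^sup>+v. ?k s u * ?k (t - s) v * (indicator A (x + u + v) * ennreal (norm (x + u) powr - \<alpha>)) \<partial>lborel) \<partial>lborel)"
  proof -
    have "(\<lambda>w. (case w of (u, v) \<Rightarrow> ?k s u * ?k (t - s) v) * ?\<phi> w) \<in> borel_measurable (lborel \<Otimes>\<^sub>M lborel)"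
      by measurable
    from lborel.nn_integral_fst[OF this] show ?thesis by simp
  qed
  also have "\<dots> = (\<integral>\<^sup>+z. (\<integral>\<^sup>+v. ?k s (z - x) * ?k (t - s) v * (indicator A (x + (z - x) + v) * ennreal (norm (x + (z - x)) powr - \<alpha>)) \<partial>lborel) \<partial>lborel)"
    by (rule nn_integral_lborel_translate[symmetric]) measurable
  also have "\<dots> = (\<integral>\<^sup>+z. (\<integral>\<^sup>+y. ?k s (z - x) * ?k (t - s) (y - z) * (indicator A (x + (z - x) + (y - z)) * ennreal (norm (x + (z - x)) powr - \<alpha>)) \<partial>lborel) \<partial>lborel)"
    by (intro nn_integral_cong nn_integral_lborel_translate[symmetric]) measurable
  also have "\<dots> = (\<integral>\<^sup>+z. (\<integral>\<^sup>+y. indicator A y *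
      ennreal (stable_kernel \<alpha> s (x - z) * norm z powr - \<alpha> * stable_kernel \<alpha> (t - s) (z - y)) \<partial>lborel) \<partial>lborel)"
  proof (intro nn_integral_cong)
    fix y z :: 'a
    have "?k s (z - x) * ?k (t - s) (y - z) * ennreal (norm z powr - \<alpha>) =
        ennreal (stable_kernel \<alpha> s (x - z) * norm z powr - \<alpha> * stable_kernel \<alpha> (t - s) (z - y))"
      using nonneg[of s] nonneg[of "t - s"] assms
      by (simp add: stable_kernel_minus_commute[of _ _ z x] stable_kernel_minus_commute[of _ _ y z] ennreal_mult mult_ac)
    thus "?k s (z - x) * ?k (t - s) (y - z) * (indicator A (x + (z - x) + (y - z)) * ennreal (norm (x + (z - x)) powr - \<alpha>)) =
        indicator A y * ennreal (stable_kernel \<alpha> s (x - z) * norm z powr - \<alpha> * stable_kernel \<alpha> (t - s) (z - y))"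
      by (auto simp: indicator_def)
  qed
  also have "\<dots> = (\<integral>\<^sup>+y. (\<integral>\<^sup>+z. indicator A y *
      ennreal (stable_kernel \<alpha> s (x - z) * norm z powr - \<alpha> * stable_kernel \<alpha> (t - s) (z - y)) \<partial>lborel) \<partial>lborel)"
    by (rule lborel_pair.Fubini') measurable
  also have "\<dots> = (\<integral>\<^sup>+y. indicator A y * (\<integral>\<^sup>+z.
      ennreal (stable_kernel \<alpha> s (x - z) * norm z powr - \<alpha> * stable_kernel \<alpha> (t - s) (z - y)) \<partial>lborel) \<partial>lborel)"
    by (intro nn_integral_cong nn_integral_cmult) measurable
  finally show ?thesis .
qed

text \<open>The functional \<open>I\<close> inside \<open>fk_weight\<close>, kept in
  \<open>ennreal\<close> because it may be infinite.\<close>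

abbreviation energy :: "real \<Rightarrow> 'b \<Rightarrow> ennreal" where
  "energy t \<omega> \<equiv> (\<integral>\<^sup>+s. indicator {0..t} s * ennreal (norm (X s \<omega>) powr - \<alpha>) \<partial>lborel)"

text \<open>Tonelli in \<open>s\<close> and \<open>\<omega>\<close>, with
  \<open>two_time_law\<close> at each \<open>s\<close>. The set avoids the origin so that
  \<open>ennreal_p1\<close> is available at each of its points.\<close>

lemma energy_law:
  assumes \<alpha>: "0 < \<alpha>" "\<alpha> < real DIM('a)" and t: "0 < t" and x: "x \<noteq> 0"
    and A[measurable]: "A \<in> sets borel" and "0 \<notin> A"
  shows "(\<integral>\<^sup>+\<omega>. indicator A (X t \<omega>) * energy t \<omega> \<partial>M) = (\<integral>\<^sup>+y. indicator A y * ennreal (p1 \<alpha> t x y) \<partial>lborel)"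
proof -
  interpret pair_sigma_finite lborel M ..
  note [measurable (raw)] = process_measurable
  have nonneg: "0 \<le> stable_kernel \<alpha> r (z::'a)" if "0 < r" for r z
    by (rule stable_kernel_nonneg_of_mass[OF that \<alpha>(1) process_mass[OF that]])
  let ?J = "\<lambda>s y. (\<integral>\<^sup>+z. ennreal (stable_kernel \<alpha> (t - s) (x - z) * norm z powr - \<alpha> * stable_kernel \<alpha> s (z - y)) \<partial>lborel)"
  have "(\<integral>\<^sup>+\<omega>. indicator A (X t \<omega>) * energy t \<omega> \<partial>M) =
      (\<integral>\<^sup>+\<omega>. (\<integral>\<^sup>+s. indicator A (X t \<omega>) * (indicator {0..t} s * ennreal (norm (X s \<omega>) powr - \<alpha>)) \<partial>lborel) \<partial>M)"
    by (intro nn_integral_cong nn_integral_cmult[symmetric]) measurable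
  also have "\<dots> = (\<integral>\<^sup>+s. (\<integral>\<^sup>+\<omega>. indicator A (X t \<omega>) * (indicator {0..t} s * ennreal (norm (X s \<omega>) powr - \<alpha>)) \<partial>M) \<partial>lborel)"
    by (rule Fubini') measurable
  \<comment> \<open>The two endpoints, where \<open>two_time_law\<close> says nothing, form a null
    set.\<close>
  also have "\<dots> = (\<integral>\<^sup>+s. indicator {0<..<t} s * (\<integral>\<^sup>+y. indicator A y * ?J (t - s) y \<partial>lborel) \<partial>lborel)"
  proof (intro nn_integral_cong_AE)
    have "(\<integral>\<^sup>+\<omega>. indicator A (X t \<omega>) * (indicator {0..t} s * ennreal (norm (X s \<omega>) powr - \<alpha>)) \<partial>M) =
        indicator {0<..<t} s * (\<integral>\<^sup>+y. indicator A y * ?J (t - s) y \<partial>lborel)" if "s \<noteq> 0" "s \<noteq> t" for s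
      using two_time_law[OF _ _ A nonneg, of s t] that by (auto simp: indicator_def[of "{0..t}"] indicator_def[of "{0<..<t}"])
    note eq = this
    show "AE s in lborel. (\<integral>\<^sup>+\<omega>. indicator A (X t \<omega>) * (indicator {0..t} s * ennreal (norm (X s \<omega>) powr - \<alpha>)) \<partial>M) =
        indicator {0<..<t} s * (\<integral>\<^sup>+y. indicator A y * ?J (t - s) y \<partial>lborel)"
      using AE_lborel_singleton[of 0] AE_lborel_singleton[of t] by eventually_elim (rule eq)
  qed
  \<comment> \<open>In \<open>two_time_law\<close> the first leg takes time \<open>s\<close>, in
    \<open>p1\<close> it takes time \<open>t - s\<close>; reflecting the time variable reconciles
    them.\<close>
  also have "\<dots> = (\<integral>\<^sup>+s. indicator {0<..<t} (t + - 1 * s) * (\<integral>\<^sup>+y. indicator A y * ?J (t - (t + - 1 * s)) y \<partial>lborel) \<partial>lborel)"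
  proof -
    have "(\<lambda>s. indicator {0<..<t} s * (\<integral>\<^sup>+y. indicator A y * ?J (t - s) y \<partial>lborel)) \<in> borel_measurable borel"
      by measurable
    from nn_integral_real_affine[OF this, of "- 1" t] show ?thesis by simp
  qed
  also have "\<dots> = (\<integral>\<^sup>+s. (\<integral>\<^sup>+y. indicator A y * (indicator {0<..<t} s * ?J s y) \<partial>lborel) \<partial>lborel)"
  proof (intro nn_integral_cong)
    fix s
    have "indicator {0<..<t} (t + - 1 * s) = (indicator {0<..<t} s :: ennreal)"
      by (auto simp: indicator_def)
    thus "indicator {0<..<t} (t + - 1 * s) * (\<integral>\<^sup>+y. indicator A y * ?J (t - (t + - 1 * s)) y \<partial>lborel) =
        (\<integral>\<^sup>+y. indicator A y * (indicator {0<..<t} s * ?J s y) \<partial>lborel)"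
      by (simp add: nn_integral_cmult[symmetric] mult_ac)
  qed
  also have "\<dots> = (\<integral>\<^sup>+y. (\<integral>\<^sup>+s. indicator A y * (indicator {0<..<t} s * ?J s y) \<partial>lborel) \<partial>lborel)"
    by (rule lborel_pair.Fubini') measurable
  also have "\<dots> = (\<integral>\<^sup>+y. indicator A y * (\<integral>\<^sup>+s. indicator {0<..<t} s * ?J s y \<partial>lborel) \<partial>lborel)"
    by (intro nn_integral_cong nn_integral_cmult) measurable
  also have "\<dots> = (\<integral>\<^sup>+y. indicator A y * ennreal (p1 \<alpha> t x y) \<partial>lborel)"
  proof (intro nn_integral_cong)
    fix y
    show "indicator A y * (\<integral>\<^sup>+s. indicator {0<..<t} s * ?J s y \<partial>lborel) = indicator A y * ennreal (p1 \<alpha> t x y)"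
    proof (cases "y \<in> A")
      case True
      hence "y \<noteq> 0" using \<open>0 \<notin> A\<close> by auto
      from ennreal_p1[OF \<alpha> t process_mass x this] show ?thesis by simp
    qed simp
  qed
  finally show ?thesis .
qed

end

section \<open>The tangent line inequality and localization at a point\<close>

lemma exp_tangent:
  fixes lam c i :: real
  shows "exp (- lam * c) * (1 + lam * c) \<le> exp (- lam * i) + exp (- lam * c) * lam * i"
proof -
  have "exp (- lam * c) * (1 + (lam * c - lam * i)) \<le> exp (- lam * c) * exp (lam * c - lam * i)"
    by (intro mult_left_mono exp_ge_add_one_self) auto
  also have "\<dots> = exp (- lam * i)" by (simp add: exp_add[symmetric])
  finally show ?thesis by (simp add: algebra_simps)
qed

text \<open>The subtracted term of the tangent is moved to the right, so that the inequality can be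
  integrated in \<open>ennreal\<close> even when the energy is infinite.\<close>

lemma fk_weight_tangent:
  assumes "0 < lam"
  shows "ennreal (exp (- lam * c) * (1 + lam * c)) \<le> ennreal (fk_weight \<alpha> lam t X \<omega>)
    + ennreal (exp (- lam * c) * lam) * energy \<alpha> X t \<omega>"
proof (cases "energy \<alpha> X t \<omega>")
  case (real i)
  hence "fk_weight \<alpha> lam t X \<omega> = exp (- lam * i)"
    by (simp add: fk_weight_def Let_def)
  thus ?thesis
    using exp_tangent[of lam c i] real assms
    by (simp add: ennreal_mult[symmetric] ennreal_plus[symmetric] ennreal_leI del: ennreal_plus)
next
  \<comment> \<open>The weight is 0 here, but the right side is infinite since the coefficient of
    the energy is positive.\<close>
  case top
  thus ?thesis using assms by (simp add: ennreal_mult_top)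
qed

lemma fk_density_tangent:
  fixes X :: "real \<Rightarrow> 'b \<Rightarrow> 'a::euclidean_space"
  assumes \<alpha>: "0 < \<alpha>" "\<alpha> < real DIM('a)" and "0 < lam" and t: "0 < t" and x: "x \<noteq> 0"
    and proc: "stable_process \<alpha> M X x" and q: "fk_density \<alpha> lam M X t q"
    and A[measurable]: "A \<in> sets borel" and "0 \<notin> A"
  shows "ennreal (exp (- lam * c) * (1 + lam * c)) * (\<integral>\<^sup>+y. indicator A y * ennreal (stable_kernel \<alpha> t (x - y)) \<partial>lborel)
    \<le> (\<integral>\<^sup>+y. indicator A y * ennreal (q y) \<partial>lborel)
      + ennreal (exp (- lam * c) * lam) * (\<integral>\<^sup>+y. indicator A y * ennreal (p1 \<alpha> t x y) \<partial>lborel)"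
proof -
  interpret prob_space M using proc by (simp add: stable_process_def)
  note [measurable (raw)] = process_measurable[OF proc]
  have [measurable]: "energy \<alpha> X t \<in> borel_measurable M"
    by measurable
  have [measurable]: "fk_weight \<alpha> lam t X \<in> borel_measurable M"
    unfolding fk_weight_def Let_def by measurable
  let ?a = "ennreal (exp (- lam * c) * (1 + lam * c))" and ?b = "ennreal (exp (- lam * c) * lam)"
  have "?a * (\<integral>\<^sup>+\<omega>. indicator A (X t \<omega>) \<partial>M) = (\<integral>\<^sup>+\<omega>. ?a * indicator A (X t \<omega>) \<partial>M)"
    by (rule nn_integral_cmult[symmetric]) measurable
  also have "\<dots> \<le> (\<integral>\<^sup>+\<omega>. indicator A (X t \<omega>) * ennreal (fk_weight \<alpha> lam t X \<omega>) + ?b * (indicator A (X t \<omega>) * energy \<alpha> X t \<omega>) \<partial>M)"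
    using fk_weight_tangent[OF \<open>0 < lam\<close>, of c \<alpha> t X] by (intro nn_integral_mono) (auto simp: indicator_def)
  also have "\<dots> = (\<integral>\<^sup>+\<omega>. indicator A (X t \<omega>) * ennreal (fk_weight \<alpha> lam t X \<omega>) \<partial>M)
      + (\<integral>\<^sup>+\<omega>. ?b * (indicator A (X t \<omega>) * energy \<alpha> X t \<omega>) \<partial>M)"
    by (rule nn_integral_add) measurable
  also have "(\<integral>\<^sup>+\<omega>. ?b * (indicator A (X t \<omega>) * energy \<alpha> X t \<omega>) \<partial>M) =
      ?b * (\<integral>\<^sup>+\<omega>. indicator A (X t \<omega>) * energy \<alpha> X t \<omega> \<partial>M)"
    by (rule nn_integral_cmult) measurable
  also have "(\<integral>\<^sup>+\<omega>. indicator A (X t \<omega>) * energy \<alpha> X t \<omega> \<partial>M) = (\<integral>\<^sup>+y. indicator A y * ennreal (p1 \<alpha> t x y) \<partial>lborel)"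
    by (rule energy_law[OF proc \<alpha> t x A \<open>0 \<notin> A\<close>])
  also have "(\<integral>\<^sup>+\<omega>. indicator A (X t \<omega>) * ennreal (fk_weight \<alpha> lam t X \<omega>) \<partial>M) = (\<integral>\<^sup>+y. indicator A y * ennreal (q y) \<partial>lborel)"
    using q A unfolding fk_density_def by metis
  finally show ?thesis unfolding one_time_law[OF proc t A] .
qed

theorem theorem4p6:
  fixes \<alpha> lam t :: real and x y :: "'a::euclidean_space"
    and M :: "'b measure" and X :: "real \<Rightarrow> 'b \<Rightarrow> 'a" and q :: "'a \<Rightarrow> real"
  assumes "0 < \<alpha>" and "\<alpha> < min (real DIM('a)) 2"
    and "lam > 0" and "t > 0" and "x \<noteq> 0" and "y \<noteq> 0"
    and "stable_process \<alpha> M X x"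
    and "continuous_on (UNIV - {0}) q" and "\<forall>z. z \<noteq> 0 \<longrightarrow> q z \<ge> 0"
    and "fk_density \<alpha> lam M X t q"
  shows "q y \<ge> stable_kernel \<alpha> t (x - y) *
           exp (- lam * p1 \<alpha> t x y / stable_kernel \<alpha> t (x - y))"
proof (cases "stable_kernel \<alpha> t (x - y) \<le> 0")
  \<comment> \<open>Strict positivity of the kernel is not established; where it fails, the claimed
    lower bound is at most 0, also for a vanishing kernel with its quotient by 0.\<close>
  case True
  have "stable_kernel \<alpha> t (x - y) * exp (- lam * p1 \<alpha> t x y / stable_kernel \<alpha> t (x - y)) \<le> 0"
    using True by (intro mult_nonpos_nonneg) auto
  thus ?thesis using assms(6,9) by (meson order_trans)
next
  case False
  have \<alpha>: "0 < \<alpha>" "\<alpha> < real DIM('a)" using assms by auto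
  note t = \<open>t > 0\<close> and proc = \<open>stable_process \<alpha> M X x\<close>
  define p where "p = stable_kernel \<alpha> t (x - y)"
  have p: "0 < p" using False by (simp add: p_def)
  define P where "P = p1 \<alpha> t x y"
  have P: "0 \<le> P" unfolding P_def by (rule p1_nonneg[OF \<alpha> t process_mass[OF proc] \<open>x \<noteq> 0\<close> \<open>y \<noteq> 0\<close>])
  \<comment> \<open>As a function of \<open>c\<close>, the bound
    \<open>exp (- lam * c) * ((1 + lam * c) * p - lam * P)\<close> has a derivative with the sign of
    \<open>P - c * p\<close>, so this value is the optimal one.\<close>
  define c where "c = P / p"
  have c: "0 \<le> c" using p P by (simp add: c_def)
  define a where "a = exp (- lam * c) * (1 + lam * c)"
  define b where "b = exp (- lam * c) * lam"
  have ab: "0 \<le> a" "0 \<le> b" using c assms(3) by (auto simp: a_def b_def)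
  have contq: "isCont q y"
    using assms(6,8) by (auto simp: continuous_on_eq_continuous_at open_delete)
  have contP: "isCont (p1 \<alpha> t x) y"
    by (rule isCont_p1[OF \<alpha> t process_mass[OF proc] \<open>x \<noteq> 0\<close> \<open>y \<noteq> 0\<close>])
  have contp: "isCont (\<lambda>y. stable_kernel \<alpha> t (x - y)) y"
    by (rule isCont_o2[where f = "\<lambda>y. x - y", OF _ isCont_stable_kernel[OF t \<alpha>(1)]]) auto
  \<comment> \<open>The integrated inequality is applied to a ball around \<open>y\<close> that
    misses the origin and on which all three functions vary by less than \<open>e\<close>; the
    volume then cancels. The condition \<open>e < p\<close> keeps \<open>p - e\<close> positive, so
    \<open>ennreal\<close> does not truncate it.\<close>
  have ineq: "a * (p - e) \<le> q y + e + b * (P + e)" if e: "0 < e" "e < p" for e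
  proof -
    have ev: "eventually (\<lambda>w. dist (q w) (q y) < e) (nhds y)"
      "eventually (\<lambda>w. dist (p1 \<alpha> t x w) P < e) (nhds y)"
      "eventually (\<lambda>w. dist (stable_kernel \<alpha> t (x - w)) p < e) (nhds y)"
      "eventually (\<lambda>w. w \<noteq> 0) (nhds y)"
      using contq contP contp e \<open>y \<noteq> 0\<close> unfolding P_def p_def isCont_def
        tendsto_at_iff_tendsto_nhds[of q] tendsto_at_iff_tendsto_nhds[of "p1 \<alpha> t x"]
        tendsto_at_iff_tendsto_nhds[of "\<lambda>y. stable_kernel \<alpha> t (x - y)"]
      by (auto intro!: tendstoD t1_space_nhds)
    hence "eventually (\<lambda>w. dist (q w) (q y) < e \<and> dist (p1 \<alpha> t x w) P < e \<and>
        dist (stable_kernel \<alpha> t (x - w)) p < e \<and> w \<noteq> 0) (nhds y)"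
      by (intro eventually_conj)
    then obtain r where r: "0 < r" and near: "\<And>w. dist w y < r \<Longrightarrow> dist (q w) (q y) < e \<and> dist (p1 \<alpha> t x w) P < e \<and>
        dist (stable_kernel \<alpha> t (x - w)) p < e \<and> w \<noteq> 0"
      unfolding eventually_nhds_metric by blast
    let ?A = "ball y r"
    define V where "V = measure lborel ?A"
    have V: "0 < V" "emeasure lborel ?A = ennreal V"
      unfolding V_def using r emeasure_bounded_finite[of ?A]
      by (auto intro!: emeasure_eq_ennreal_measure)
    have near_le: "q w \<le> q y + e" "p1 \<alpha> t x w \<le> P + e" "p - e \<le> stable_kernel \<alpha> t (x - w)" if "w \<in> ?A" for w
      using near[of w] that by (auto simp: dist_commute dist_real_def)
    have int_const: "(\<integral>\<^sup>+w. indicator ?A w * ennreal m \<partial>lborel) = ennreal (m * V)" if "0 \<le> m" for m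
      unfolding mult.commute[of "indicator _ _"] using that V
      by (subst nn_integral_cmult_indicator) (simp_all add: ennreal_mult)
    have qe: "0 \<le> q y" using assms(6,9) by simp
    have "ennreal (a * ((p - e) * V)) = ennreal a * (\<integral>\<^sup>+w. indicator ?A w * ennreal (p - e) \<partial>lborel)"
      using e ab V(1) by (subst int_const) (auto simp: ennreal_mult)
    also have "\<dots> \<le> ennreal a * (\<integral>\<^sup>+w. indicator ?A w * ennreal (stable_kernel \<alpha> t (x - w)) \<partial>lborel)"
      using near_le by (intro mult_left_mono[of "integral\<^sup>N _ _"] nn_integral_mono) (auto simp: indicator_def intro!: ennreal_leI)
    also have "\<dots> \<le> (\<integral>\<^sup>+w. indicator ?A w * ennreal (q w) \<partial>lborel)
        + ennreal b * (\<integral>\<^sup>+w. indicator ?A w * ennreal (p1 \<alpha> t x w) \<partial>lborel)"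
      unfolding a_def b_def
      by (rule fk_density_tangent[OF \<alpha> assms(3) t assms(5) proc assms(10)]) (use near[of 0] in \<open>auto simp: dist_commute\<close>)
    also have "\<dots> \<le> (\<integral>\<^sup>+w. indicator ?A w * ennreal (q y + e) \<partial>lborel)
        + ennreal b * (\<integral>\<^sup>+w. indicator ?A w * ennreal (P + e) \<partial>lborel)"
      using near_le by (intro add_mono mult_left_mono[of "integral\<^sup>N _ _"] nn_integral_mono) (auto simp: indicator_def intro!: ennreal_leI)
    also have "\<dots> = ennreal ((q y + e) * V + b * ((P + e) * V))"
      using e ab V(1) P qe by (subst (1 2) int_const) (auto simp: ennreal_mult[symmetric] ennreal_plus[symmetric] simp del: ennreal_plus)
    finally have "a * ((p - e) * V) \<le> (q y + e) * V + b * ((P + e) * V)"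
      using e ab V(1) P qe by (subst (asm) ennreal_le_iff) auto
    hence "(a * (p - e)) * V \<le> (q y + e + b * (P + e)) * V" by (simp add: algebra_simps)
    thus ?thesis using V(1) by simp
  qed
  have "((\<lambda>e. a * (p - e)) \<longlongrightarrow> a * (p - 0)) (at_right 0)"
    "((\<lambda>e. q y + e + b * (P + e)) \<longlongrightarrow> q y + 0 + b * (P + 0)) (at_right 0)"
    by (intro tendsto_intros)+
  moreover have "eventually (\<lambda>e. a * (p - e) \<le> q y + e + b * (P + e)) (at_right 0)"
    unfolding eventually_at_right_field using p ineq by blast
  ultimately have "a * (p - 0) \<le> q y + 0 + b * (P + 0)"
    by (intro tendsto_le[OF trivial_limit_at_right_real])
  \<comment> \<open>Since \<open>c * p = P\<close>, the term of \<open>a * p\<close> that is linear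
    in \<open>c\<close> is exactly \<open>b * P\<close> and cancels against the right side.\<close>
  moreover have "a * p = exp (- lam * c) * p + b * P"
    using p by (simp add: a_def b_def c_def field_simps)
  ultimately have "p * exp (- lam * c) \<le> q y" by (simp add: mult.commute)
  thus ?thesis by (simp add: c_def P_def p_def)
qed

end
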